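(* Let $(X,\mathcal{B},\mu,T)$ be a measure theoretical dynamical system (not necessarily ergodic) and let $\mathcal{U}$ be a cover of $X$. Then $h_\mu^+(\mathcal{U})=h_\mu^-(\mathcal{U})$.
   Context: A measure theoretical dynamical system is a four-tuple $(X,\mathcal{B},\mu,T)$, where $(X,\mathcal{B})$ is a standard space (i.e. isomorphic to $[0,1]$ with the Borel $\sigma$-algebra), $\mu$ is a probability measure on $(X,\mathcal{B})$ and $T$ is an invertible measure preserving transformation of $X$. A cover of $X$ is a finite collection of measurable sets whose union is $X$; a partition is a cover whose elements are mutually disjoint. A cover $\mathcal{U}$ is finer than a cover $\mathcal{V}$, written $\mathcal{U}\succeq\mathcal{V}$, if every element of $\mathcal{U}$ is contained in an element of $\mathcal{V}$. The join $\mathcal{U}\vee\mathcal{V}$ is the cover whose elements are the sets $U\cap V$ with $U\in\mathcal{U}$, $V\in\mathcal{V}$; $T^k(\mathcal{U})$ is the cover with elements $T^k(U)$, $U\in\mathcal{U}$; and $\mathcal{U}_0^{n-1}=\mathcal{U}\vee T^{-1}(\mathcal{U})\vee\dots\vee T^{-(n-1)}(\mathcal{U})$. For a partition $\alpha$, $H_\mu(\alpha)=-\sum_{A\in\alpha}\mu(A)\log\mu(A)$, and $h_\mu(\alpha)=\lim_{n}\frac1n H_\mu(\alpha_0^{n-1})$ is the usual measure theoretical entropy of $\alpha$ with respect to $T$. For a cover $\mathcal{V}$, $H_\mu(\mathcal{V})=\inf\{H_\mu(\alpha):\alpha\text{ a partition of }X,\ \alpha\succeq\mathcal{V}\}$.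 For a cover $\mathcal{U}$ define $$h_\mu^+(\mathcal{U})=\inf\{h_\mu(\alpha) : \alpha \text{ a partition of } X,\ \alpha\succeq\mathcal{U}\},\qquad h_\mu^-(\mathcal{U})=\lim_{n\to\infty}\frac1n H_\mu(\mathcal{U}_0^{n-1}),$$ the last limit existing because the sequence $H_\mu(\mathcal{U}_0^{n-1})$ is sub-additive. *)

theory Defs
  imports "HOL-Probability.Probability"
begin

definition measurable_isomorphic :: "'a measure \<Rightarrow> 'b measure \<Rightarrow> bool" where
  "measurable_isomorphic M N \<longleftrightarrow>
     (\<exists>f g. f \<in> measurable M N \<and> g \<in> measurable N M \<and>
            (\<forall>x\<in>space M. g (f x) = x) \<and> (\<forall>y\<in>space N. f (g y) = y))"

locale mt_dynamical_system = prob_space M for M :: "'a measure" +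
  fixes T :: "'a \<Rightarrow> 'a"
  assumes standard: "measurable_isomorphic M (restrict_space borel {0..1::real})"
    and T_measurable: "T \<in> measurable M M"
    and T_bij: "bij_betw T (space M) (space M)"
    and T_inv_measurable: "inv_into (space M) T \<in> measurable M M"
    and T_preserving: "distr M M T = M"

definition cover :: "'a measure \<Rightarrow> 'a set set \<Rightarrow> bool" where
  "cover M \<U> \<longleftrightarrow> finite \<U> \<and> \<U> \<subseteq> sets M \<and> \<Union>\<U> = space M"

text \<open>The library's \<open>partition_on\<close> forbids the empty set as a member; here it is allowed.\<close>

definition mpartition :: "'a measure \<Rightarrow> 'a set set \<Rightarrow> bool" where
  "mpartition M \<alpha> \<longleftrightarrow> cover M \<alpha> \<and> disjoint \<alpha>"

definition finer :: "'a set set \<Rightarrow> 'a set set \<Rightarrow> bool" where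
  "finer \<U> \<V> \<longleftrightarrow> (\<forall>U\<in>\<U>. \<exists>V\<in>\<V>. U \<subseteq> V)"

definition join :: "'a set set \<Rightarrow> 'a set set \<Rightarrow> 'a set set" where
  "join \<U> \<V> = {U \<inter> V | U V. U \<in> \<U> \<and> V \<in> \<V>}"

definition pullback :: "'a measure \<Rightarrow> ('a \<Rightarrow> 'a) \<Rightarrow> nat \<Rightarrow> 'a set set \<Rightarrow> 'a set set" where
  "pullback M T k \<U> = (\<lambda>U. (T ^^ k) -` U \<inter> space M) ` \<U>"

text \<open>\<open>iterated_join M T \<U> n\<close> is the join of \<open>T\<^sup>-\<^sup>k \<U>\<close> over \<open>0 \<le> k < n\<close>, usually written
  \<open>\<U>\<close> with lower index \<open>0\<close> and upper index \<open>n - 1\<close>; for \<open>n = 0\<close> it is the trivial cover.\<close>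

primrec iterated_join :: "'a measure \<Rightarrow> ('a \<Rightarrow> 'a) \<Rightarrow> 'a set set \<Rightarrow> nat \<Rightarrow> 'a set set" where
  "iterated_join M T \<U> 0 = {space M}"
| "iterated_join M T \<U> (Suc n) = join (iterated_join M T \<U> n) (pullback M T n \<U>)"

text \<open>The convention \<open>0 log 0 = 0\<close> holds because of the factor \<open>measure M A\<close>.\<close>

definition partition_entropy :: "'a measure \<Rightarrow> 'a set set \<Rightarrow> real" where
  "partition_entropy M \<alpha> = - (\<Sum>A\<in>\<alpha>. measure M A * ln (measure M A))"

definition cover_entropy :: "'a measure \<Rightarrow> 'a set set \<Rightarrow> real" where
  "cover_entropy M \<V> = (INF \<alpha>\<in>{\<alpha>. mpartition M \<alpha> \<and> finer \<alpha> \<V>}. partition_entropy M \<alpha>)"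

definition ks_entropy :: "'a measure \<Rightarrow> ('a \<Rightarrow> 'a) \<Rightarrow> 'a set set \<Rightarrow> real" where
  "ks_entropy M T \<alpha> = lim (\<lambda>n. partition_entropy M (iterated_join M T \<alpha> n) / real n)"

definition h_plus :: "'a measure \<Rightarrow> ('a \<Rightarrow> 'a) \<Rightarrow> 'a set set \<Rightarrow> real" where
  "h_plus M T \<U> = (INF \<alpha>\<in>{\<alpha>. mpartition M \<alpha> \<and> finer \<alpha> \<U>}. ks_entropy M T \<alpha>)"

definition h_minus :: "'a measure \<Rightarrow> ('a \<Rightarrow> 'a) \<Rightarrow> 'a set set \<Rightarrow> real" where
  "h_minus M T \<U> = lim (\<lambda>n. cover_entropy M (iterated_join M T \<U> n) / real n)"

end

theory Submission
  imports Defs "HOL-Real_Asymp.Real_Asymp"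
begin

text \<open>The inequality \<open>h_minus \<le> h_plus\<close> is soft. If a partition \<open>\<alpha>\<close> is finer than \<open>\<U>\<close>, then its iterated
  joins are finer than those of \<open>\<U>\<close>, hence have at least their entropy (\<open>h_minus_le_ks_entropy\<close>).
  All the limits in question exist by one application of Fekete's lemma: a partition has the least
  entropy among the partitions finer than it, so that \<open>ks_entropy\<close> is \<open>h_minus\<close> on partitions.

  The converse is a block code. Fix \<open>N\<close> and a partition \<open>\<beta>\<close> finer than the join of
  \<open>\<U>, T\<^sup>-\<^sup>1\<U>, \<dots>\<close> over \<open>N\<close> times, with \<open>H(\<beta>)\<close> nearly minimal. Each atom \<open>B\<close> of \<open>\<beta>\<close> carries an itinerary:
  members \<open>s\<^sub>0, \<dots>, s\<^sub>N\<^sub>-\<^sub>1\<close> of \<open>\<U>\<close> that the points of \<open>B\<close> visit at the times \<open>0, \<dots>, N - 1\<close>. Suppose that almost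
  all of the space is cut measurably into orbit blocks of length \<open>N\<close>. Label the \<open>i\<close>-th point of a block by the
  \<open>i\<close>-th entry of the itinerary of the atom that contains the first point of the block. This labelling is
  a partition finer than \<open>\<U>\<close>, and along an orbit it only depends on the atom of \<open>\<beta>\<close> at the first
  points of the blocks, which have density \<open>1/N\<close>. So its entropy rate should be about \<open>H(\<beta>) / N\<close>, which is
  close to \<open>h_minus\<close> when \<open>N\<close> is large.

  Three points make this precise.

  \<^item> \<^emph>\<open>Cutting.\<close> Away from the points of period less than \<open>L\<close> there is a marker set (\<open>marker_set\<close>): a set
    whose preimages at the times \<open>0, \<dots>, L - 1\<close> are disjoint and that every orbit visits. It comes from a greedy
    union over countably many sets that are disjoint from their first \<open>L - 1\<close> translates.
    Its measure is at most \<open>1/L\<close>, and counting down the time to the next visit modulo \<open>N\<close> cuts orbits into blocks, up to a set of measure \<open>2N/L\<close>.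

  \<^item> \<^emph>\<open>Dependence on the base.\<close> The first points of the blocks could be correlated with \<open>\<beta>\<close>. There are \<open>N\<close> choices
    of the residue at which blocks start, and the \<open>N\<close> sets of first points are disjoint. The contributions of \<open>\<beta>\<close>
    restricted to these sets therefore sum to at most \<open>H(\<beta>) + ln (N + 1)\<close> (\<open>sum_eta_slices_le\<close>), and averaging over
    the residue gives \<open>H(\<beta>) / N\<close> up to a vanishing error.

  \<^item> \<^emph>\<open>Short periods.\<close> There the label of a point is a default choice of a member of \<open>\<U>\<close>
    around it. Since \<open>L!\<close> is a common period, the names of all lengths are determined by the
    name of length \<open>L!\<close>, so that this part contributes a bounded amount to the entropy of names of length \<open>n\<close>, and nothing to the rate (\<open>block_code\<close>).

  Entropies are computed for simple functions rather than for set systems: names, block codes and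
  joint observations are then functions of each other, and the inequalities that matter are data processing,
  subadditivity for pairs, and the logarithm of the number of values as an upper bound.\<close>

section \<open>Entropy of simple functions\<close>

definition eta :: "real \<Rightarrow> real" where
  "eta p = - (p * ln p)"

lemma eta_0 [simp]: "eta 0 = 0"
  by (simp add: eta_def)

lemma eta_nonneg: "0 \<le> p \<Longrightarrow> p \<le> 1 \<Longrightarrow> 0 \<le> eta p"
  by (cases "p = 0") (auto simp: eta_def mult_nonneg_nonpos)

lemma eta_le_one_minus:
  assumes "0 \<le> p" shows "eta p \<le> 1 - p"
proof (cases "p = 0")
  case False
  with assms have "p > 0" by simp
  from \<open>p > 0\<close> have "ln (inverse p) \<le> inverse p - 1" by (intro ln_le_minus_one) simp
  with \<open>p > 0\<close> have "p * ln (inverse p) \<le> p * (inverse p - 1)" by (intro mult_left_mono) simp_all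
  with \<open>p > 0\<close> show ?thesis by (simp add: eta_def ln_inverse algebra_simps)
qed simp

text \<open>This is the library's \<open>entropy\<close> to base \<open>e\<close>, as \<open>sf_entropy_eq_entropy\<close> shows. The explicit sum is kept as the
  definition because the estimate for block codes splits the sum into parts.\<close>

definition sf_entropy :: "'a measure \<Rightarrow> ('a \<Rightarrow> 'b) \<Rightarrow> real" where
  "sf_entropy M X = (\<Sum>v\<in>X ` space M. eta (measure M (X -` {v} \<inter> space M)))"

lemma sf_entropy_eq_sum:
  assumes "finite A" "X ` space M \<subseteq> A"
  shows "sf_entropy M X = (\<Sum>v\<in>A. eta (measure M (X -` {v} \<inter> space M)))"
  unfolding sf_entropy_def
proof (rule sum.mono_neutral_left[OF assms])
  show "\<forall>v\<in>A - X ` space M. eta (measure M (X -` {v} \<inter> space M)) = 0"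
  proof
    fix v assume "v \<in> A - X ` space M"
    then have "X -` {v} \<inter> space M = {}" by auto
    then show "eta (measure M (X -` {v} \<inter> space M)) = 0" by simp
  qed
qed

lemma simple_function_factor:
  assumes "simple_function M X" "\<And>x. x \<in> space M \<Longrightarrow> Y x = f (X x)"
  shows "simple_function M Y"
  using simple_function_compose1[OF assms(1), of f] assms(2) by (simp cong: simple_function_cong)

context prob_space
begin

lemma sf_entropy_eq_entropy:
  assumes "simple_function M X"
  shows "sf_entropy M X = entropy (exp 1) (count_space (X ` space M)) X"
proof -
  interpret information_space M "exp 1" by unfold_locales simp
  show ?thesis
    unfolding entropy_simple_distributed[OF simple_distributedI[OF assms measure_nonneg refl]]
    by (simp add: sf_entropy_def eta_def sum_negf log_def)
qed

lemma sf_entropy_nonneg: "0 \<le> sf_entropy M X"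
  unfolding sf_entropy_def by (intro sum_nonneg eta_nonneg) auto

text \<open>Data processing: whenever \<open>Y\<close> is computed from \<open>X\<close>, its entropy is at most that of \<open>X\<close>. Comparisons
  between partitions all reduce to this.\<close>

lemma sf_entropy_factor_le:
  assumes X: "simple_function M X" and Y: "\<And>x. x \<in> space M \<Longrightarrow> Y x = f (X x)"
  shows "sf_entropy M Y \<le> sf_entropy M X"
proof -
  interpret information_space M "exp 1" by unfold_locales simp
  have "sf_entropy M Y = sf_entropy M (f \<circ> X)"
    unfolding sf_entropy_def using Y
    by (intro sum.cong arg_cong[of _ _ eta] arg_cong[of _ _ prob]) auto
  also have "\<dots> \<le> sf_entropy M X"
    using entropy_data_processing[OF X, of f] simple_function_compose[OF X, of f] X
    by (simp add: sf_entropy_eq_entropy)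
  finally show ?thesis .
qed

lemma sf_entropy_Pair_le:
  assumes X: "simple_function M X" and Y: "simple_function M Y"
  shows "sf_entropy M (\<lambda>x. (X x, Y x)) \<le> sf_entropy M X + sf_entropy M Y"
proof -
  interpret information_space M "exp 1" by unfold_locales simp
  show ?thesis
    using entropy_chain_rule[OF X Y] conditional_entropy_less_eq_entropy[OF Y X]
      X Y simple_function_Pair[OF X Y]
    by (simp add: sf_entropy_eq_entropy)
qed

lemma sf_entropy_le_card:
  assumes X: "simple_function M X" and A: "finite A" "X ` space M \<subseteq> A"
  shows "sf_entropy M X \<le> ln (card A)"
proof -
  interpret information_space M "exp 1" by unfold_locales simp
  have "sf_entropy M X \<le> ln (card (X ` space M))"
    using entropy_le_card[OF simple_distributedI[OF X measure_nonneg refl]] X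
    by (simp add: sf_entropy_eq_entropy log_def)
  moreover have "card (X ` space M) > 0" "card (X ` space M) \<le> card A"
    using A not_empty by (auto simp: card_gt_0_iff card_mono intro: finite_subset)
  ultimately show ?thesis
    by (smt (verit) ln_le_cancel_iff of_nat_0_less_iff of_nat_mono)
qed

end

section \<open>Entropy of partitions and covers\<close>

text \<open>The atom of \<open>x\<close> when \<open>\<alpha>\<close> is a partition. It turns \<open>\<alpha>\<close> into a simple function whose values are the atoms
  themselves, so that empty members of \<open>\<alpha>\<close> are never attained.\<close>

definition cell :: "'a set set \<Rightarrow> 'a \<Rightarrow> 'a set" where
  "cell \<alpha> x = \<Union>{A\<in>\<alpha>. x \<in> A}"

lemma cell_eq:
  assumes "mpartition M \<alpha>" "A \<in> \<alpha>" "x \<in> A"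
  shows "cell \<alpha> x = A"
proof -
  have "{B\<in>\<alpha>. x \<in> B} = {A}"
    using assms by (auto simp: mpartition_def disjoint_def)
  then show ?thesis by (simp add: cell_def)
qed

lemma cell_in:
  assumes "mpartition M \<alpha>" "x \<in> space M"
  shows "cell \<alpha> x \<in> \<alpha>" "x \<in> cell \<alpha> x"
proof -
  from assms obtain A where A: "A \<in> \<alpha>" "x \<in> A" by (auto simp: mpartition_def cover_def)
  with cell_eq[OF assms(1) this] show "cell \<alpha> x \<in> \<alpha>" "x \<in> cell \<alpha> x" by auto
qed

lemma cell_vimage:
  assumes "mpartition M \<alpha>" "A \<in> \<alpha>"
  shows "cell \<alpha> -` {A} \<inter> space M = A"
  using assms cell_in[OF assms(1)] cell_eq[OF assms(1)]
  by (auto simp: mpartition_def cover_def)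

lemma simple_function_cell:
  assumes "mpartition M \<alpha>" shows "simple_function M (cell \<alpha>)"
  unfolding simple_function_def
proof
  have sub: "cell \<alpha> ` space M \<subseteq> \<alpha>" using cell_in[OF assms] by auto
  show "finite (cell \<alpha> ` space M)"
    using finite_subset[OF sub] assms by (auto simp: mpartition_def cover_def)
  show "\<forall>A\<in>cell \<alpha> ` space M. cell \<alpha> -` {A} \<inter> space M \<in> sets M"
  proof
    fix A assume "A \<in> cell \<alpha> ` space M"
    with sub have "A \<in> \<alpha>" by blast
    with cell_vimage[OF assms this] assms show "cell \<alpha> -` {A} \<inter> space M \<in> sets M"
      by (auto simp: mpartition_def cover_def)
  qed
qed

lemma partition_entropy_eq:
  assumes "mpartition M \<alpha>"
  shows "partition_entropy M \<alpha> = sf_entropy M (cell \<alpha>)"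
proof -
  have "sf_entropy M (cell \<alpha>) = (\<Sum>A\<in>\<alpha>. eta (measure M (cell \<alpha> -` {A} \<inter> space M)))"
    using cell_in[OF assms] assms
    by (intro sf_entropy_eq_sum) (auto simp: mpartition_def cover_def)
  also have "\<dots> = (\<Sum>A\<in>\<alpha>. eta (measure M A))"
    using cell_vimage[OF assms] by simp
  finally show ?thesis by (simp add: partition_entropy_def eta_def sum_negf)
qed

lemma mpartition_labels:
  assumes X: "simple_function M X" and F: "finite F" "X ` space M \<subseteq> F"
  defines "\<alpha> \<equiv> (\<lambda>v. X -` {v} \<inter> space M) ` F"
  shows "mpartition M \<alpha>" and "x \<in> space M \<Longrightarrow> cell \<alpha> x = X -` {X x} \<inter> space M"
proof -
  show m: "mpartition M \<alpha>"
    unfolding mpartition_def cover_def \<alpha>_def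
    using F simple_functionD(2)[OF X] by (auto simp: disjoint_def)
  show "cell \<alpha> x = X -` {X x} \<inter> space M" if "x \<in> space M"
    using that F by (intro cell_eq[OF m]) (auto simp: \<alpha>_def)
qed

lemma cover_join:
  assumes "cover M U" "cover M V" shows "cover M (join U V)"
proof -
  have "join U V = (\<lambda>(A, B). A \<inter> B) ` (U \<times> V)" by (auto simp: join_def)
  then have "finite (join U V)" using assms by (simp add: cover_def)
  moreover have "\<Union>(join U V) = \<Union>U \<inter> \<Union>V" by (auto simp: join_def)
  moreover have "join U V \<subseteq> sets M" using assms by (auto simp: cover_def join_def)
  ultimately show ?thesis using assms by (simp add: cover_def)
qed

lemma mpartition_join:
  assumes "mpartition M \<alpha>" "mpartition M \<beta>" shows "mpartition M (join \<alpha> \<beta>)"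
proof -
  have "disjoint (join \<alpha> \<beta>)"
    unfolding disjoint_def join_def
  proof clarify
    fix A B A' B' assume *: "A \<in> \<alpha>" "B \<in> \<beta>" "A' \<in> \<alpha>" "B' \<in> \<beta>" "A \<inter> B \<noteq> A' \<inter> B'"
    then have "A \<noteq> A' \<or> B \<noteq> B'" by auto
    then have "A \<inter> A' = {} \<or> B \<inter> B' = {}"
      using assms * unfolding mpartition_def disjoint_def by meson
    then show "A \<inter> B \<inter> (A' \<inter> B') = {}" by auto
  qed
  then show ?thesis using assms cover_join by (auto simp: mpartition_def)
qed

lemma cell_join:
  assumes "mpartition M \<alpha>" "mpartition M \<beta>" "x \<in> space M"
  shows "cell (join \<alpha> \<beta>) x = cell \<alpha> x \<inter> cell \<beta> x"
proof (rule cell_eq[OF mpartition_join[OF assms(1,2)]])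
  show "cell \<alpha> x \<inter> cell \<beta> x \<in> join \<alpha> \<beta>"
    using cell_in[OF assms(1,3)] cell_in[OF assms(2,3)] unfolding join_def by blast
qed (use cell_in[OF assms(1,3)] cell_in[OF assms(2,3)] in auto)

lemma finer_refl: "finer \<U> \<U>"
  by (auto simp: finer_def)

lemma finer_join: "finer \<U> \<U>' \<Longrightarrow> finer \<V> \<V>' \<Longrightarrow> finer (join \<U> \<V>) (join \<U>' \<V>')"
  unfolding finer_def join_def by (clarsimp simp: Bex_def) (metis Int_mono)

context prob_space
begin

lemma partition_entropy_join_le:
  assumes "mpartition M \<alpha>" "mpartition M \<beta>"
  shows "partition_entropy M (join \<alpha> \<beta>) \<le> partition_entropy M \<alpha> + partition_entropy M \<beta>"
proof -
  note sf = simple_function_cell[OF assms(1)] simple_function_cell[OF assms(2)]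
  have "sf_entropy M (cell (join \<alpha> \<beta>)) \<le> sf_entropy M (\<lambda>x. (cell \<alpha> x, cell \<beta> x))"
    by (rule sf_entropy_factor_le[where f = "\<lambda>(A, B). A \<inter> B"])
      (simp_all add: simple_function_Pair sf cell_join[OF assms])
  also have "\<dots> \<le> sf_entropy M (cell \<alpha>) + sf_entropy M (cell \<beta>)"
    by (rule sf_entropy_Pair_le[OF sf])
  finally show ?thesis using assms by (simp add: partition_entropy_eq mpartition_join)
qed

text \<open>A nonempty atom of \<open>\<alpha>\<close> lies in exactly one atom of \<open>\<beta>\<close>, so the atom of \<open>\<beta>\<close> is a function of the atom
  of \<open>\<alpha>\<close>.\<close>

lemma partition_entropy_finer_le:
  assumes a: "mpartition M \<alpha>" and b: "mpartition M \<beta>" and fin: "finer \<alpha> \<beta>"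
  shows "partition_entropy M \<beta> \<le> partition_entropy M \<alpha>"
proof -
  obtain f where f: "\<And>A. A \<in> \<alpha> \<Longrightarrow> f A \<in> \<beta> \<and> A \<subseteq> f A"
    using fin unfolding finer_def by metis
  have "sf_entropy M (cell \<beta>) \<le> sf_entropy M (cell \<alpha>)"
  proof (rule sf_entropy_factor_le[OF simple_function_cell[OF a]])
    fix x assume x: "x \<in> space M"
    with f[OF cell_in(1)[OF a x]] cell_in(2)[OF a x] show "cell \<beta> x = f (cell \<alpha> x)"
      by (intro cell_eq[OF b]) auto
  qed
  then show ?thesis using a b by (simp add: partition_entropy_eq)
qed

lemma partition_entropy_nonneg: "mpartition M \<alpha> \<Longrightarrow> 0 \<le> partition_entropy M \<alpha>"
  by (simp add: partition_entropy_eq sf_entropy_nonneg)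

text \<open>Enumerate the cover and send \<open>x\<close> to the first member that contains it.\<close>

lemma simple_selection:
  assumes "cover M \<U>"
  obtains d where "simple_function M d" "\<And>x. x \<in> space M \<Longrightarrow> d x \<in> \<U> \<and> x \<in> d x"
proof -
  obtain us where us: "set us = \<U>" using assms by (auto simp: cover_def dest: finite_list)
  define k where "k x = (LEAST i. i < length us \<and> x \<in> us ! i)" for x
  have k: "k x < length us \<and> x \<in> us ! k x" if "x \<in> space M" for x
    unfolding k_def
  proof (rule LeastI_ex)
    show "\<exists>i. i < length us \<and> x \<in> us ! i"
    proof -
      from that assms obtain U where "U \<in> set us" "x \<in> U"
        unfolding us cover_def by blast
      then show ?thesis unfolding in_set_conv_nth by blast
    qed
  qed
  have [measurable]: "us ! i \<in> sets M" if "i < length us" for i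
    using that us assms nth_mem[of i us] by (auto simp: cover_def)
  have "k \<in> measurable M (count_space UNIV)"
    unfolding k_def
  proof (rule measurable_Least)
    fix i show "Measurable.pred M (\<lambda>x. i < length us \<and> x \<in> us ! i)"
      by (cases "i < length us") simp_all
  qed
  moreover have "k ` space M \<subseteq> {..<length us}"
    using k by blast
  then have "finite (k ` space M)"
    by (rule finite_subset) simp
  ultimately have "simple_function M k"
    by (simp add: simple_function_eq_measurable)
  then have "simple_function M (\<lambda>x. us ! k x)"
    by (rule simple_function_compose1)
  then show ?thesis
  proof (rule that)
    fix x assume "x \<in> space M"
    from k[OF this] us show "us ! k x \<in> \<U> \<and> x \<in> us ! k x"
      using nth_mem by blast
  qed
qed

text \<open>Partitions finer than \<open>\<U>\<close> are produced from measurable choices of a member of \<open>\<U>\<close> around each point; the last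
  clause expresses the atom of \<open>x\<close> through the chosen member, which is what data processing asks for.\<close>

lemma selection_partition:
  assumes U: "cover M \<U>" and d: "simple_function M d" "\<And>x. x \<in> space M \<Longrightarrow> d x \<in> \<U> \<and> x \<in> d x"
  defines "\<alpha> \<equiv> (\<lambda>v. d -` {v} \<inter> space M) ` \<U>"
  shows "mpartition M \<alpha>" "finer \<alpha> \<U>" "x \<in> space M \<Longrightarrow> cell \<alpha> x = d -` {d x} \<inter> space M"
proof -
  have F: "finite \<U>" "d ` space M \<subseteq> \<U>" using U d(2) by (auto simp: cover_def)
  show "mpartition M \<alpha>" "x \<in> space M \<Longrightarrow> cell \<alpha> x = d -` {d x} \<inter> space M"
    unfolding \<alpha>_def using mpartition_labels[OF d(1) F] by auto
  show "finer \<alpha> \<U>"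
    unfolding finer_def \<alpha>_def
  proof (intro ballI)
    fix A assume "A \<in> (\<lambda>v. d -` {v} \<inter> space M) ` \<U>"
    then obtain V where "V \<in> \<U>" "A = d -` {V} \<inter> space M" by blast
    with d(2) show "\<exists>V\<in>\<U>. A \<subseteq> V" by (intro bexI[of _ V]) auto
  qed
qed

lemma finer_partitions_nonempty:
  assumes "cover M \<U>" shows "{\<alpha>. mpartition M \<alpha> \<and> finer \<alpha> \<U>} \<noteq> {}"
proof -
  obtain d where d: "simple_function M d" "\<And>x. x \<in> space M \<Longrightarrow> d x \<in> \<U> \<and> x \<in> d x"
    using simple_selection[OF assms] by blast
  show ?thesis using selection_partition(1,2)[OF assms d] by auto
qed

lemma cover_entropy_le:
  assumes "mpartition M \<alpha>" "finer \<alpha> \<U>"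
  shows "cover_entropy M \<U> \<le> partition_entropy M \<alpha>"
  unfolding cover_entropy_def
  by (rule cINF_lower) (use assms partition_entropy_nonneg in \<open>auto intro!: bdd_belowI[of _ 0]\<close>)

lemma cover_entropy_greatest:
  assumes "cover M \<U>" "\<And>\<alpha>. mpartition M \<alpha> \<Longrightarrow> finer \<alpha> \<U> \<Longrightarrow> c \<le> partition_entropy M \<alpha>"
  shows "c \<le> cover_entropy M \<U>"
  unfolding cover_entropy_def
  by (rule cINF_greatest) (use assms finer_partitions_nonempty[OF assms(1)] in auto)

lemma cover_entropy_partition:
  assumes "mpartition M \<alpha>" shows "cover_entropy M \<alpha> = partition_entropy M \<alpha>"
proof (rule antisym)
  show "cover_entropy M \<alpha> \<le> partition_entropy M \<alpha>"
    by (rule cover_entropy_le[OF assms finer_refl])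
  show "partition_entropy M \<alpha> \<le> cover_entropy M \<alpha>"
    using assms partition_entropy_finer_le
    by (intro cover_entropy_greatest) (auto simp: mpartition_def)
qed

lemma cover_entropy_join_le:
  assumes U: "cover M \<U>" and V: "cover M \<V>"
  shows "cover_entropy M (join \<U> \<V>) \<le> cover_entropy M \<U> + cover_entropy M \<V>"
proof -
  have *: "cover_entropy M (join \<U> \<V>) \<le> partition_entropy M \<alpha> + partition_entropy M \<beta>"
    if "mpartition M \<alpha>" "finer \<alpha> \<U>" "mpartition M \<beta>" "finer \<beta> \<V>" for \<alpha> \<beta>
    using cover_entropy_le[OF mpartition_join[OF that(1,3)] finer_join[OF that(2,4)]]
      partition_entropy_join_le[OF that(1,3)] by simp
  have "cover_entropy M (join \<U> \<V>) - partition_entropy M \<alpha> \<le> cover_entropy M \<V>"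
    if "mpartition M \<alpha>" "finer \<alpha> \<U>" for \<alpha>
    by (rule cover_entropy_greatest[OF V]) (use *[OF that] in \<open>simp add: algebra_simps\<close>)
  then have "cover_entropy M (join \<U> \<V>) - cover_entropy M \<V> \<le> cover_entropy M \<U>"
    by (intro cover_entropy_greatest[OF U]) (simp add: algebra_simps)
  then show ?thesis by simp
qed

end

section \<open>Subadditive sequences\<close>

text \<open>Division of \<open>n\<close> by \<open>k\<close> with remainder.\<close>

lemma subadditive_le:
  fixes a :: "nat \<Rightarrow> real"
  assumes sub: "\<And>m n. a (m + n) \<le> a m + a n" and nn: "\<And>n. 0 \<le> a n" and k: "k > 0"
  shows "a n / n \<le> a k / k + (MAX i\<in>{..<k}. a i) / n"
proof (cases "n = 0")
  case True then show ?thesis using nn by simp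
next
  case False
  have mult: "a (q * k + r) \<le> q * a k + a r" for q r
  proof (induction q)
    case (Suc q)
    then show ?case using sub[of k "q * k + r"] by (simp add: algebra_simps)
  qed simp
  have "a n \<le> (n div k) * a k + a (n mod k)"
    using mult[of "n div k" "n mod k"] by simp
  also have "real (n div k) \<le> n / k" by (simp add: of_nat_div_le_of_nat)
  also have "a (n mod k) \<le> (MAX i\<in>{..<k}. a i)"
    using k by (intro Max_ge) auto
  finally have "a n \<le> n / k * a k + (MAX i\<in>{..<k}. a i)"
    using nn[of k] by (simp add: mult_right_mono)
  then show ?thesis using False by (simp add: field_simps)
qed

text \<open>Fekete's lemma: the limit is the infimum of \<open>a k / k\<close> over \<open>k > 0\<close>.\<close>

lemma subadditive_convergent:
  fixes a :: "nat \<Rightarrow> real"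
  assumes sub: "\<And>m n. a (m + n) \<le> a m + a n" and nn: "\<And>n. 0 \<le> a n"
  shows "convergent (\<lambda>n. a n / n)"
proof -
  define l where "l = (INF k\<in>{0<..}. a k / real k)"
  have bdd: "bdd_below ((\<lambda>k. a k / real k) ` {0<..})"
    using nn by (auto intro!: bdd_belowI[of _ 0])
  have "(\<lambda>n. a n / n) \<longlonglongrightarrow> l"
  proof (rule order_tendstoI)
    fix y assume "y < l"
    have "l \<le> a n / n" if "n > 0" for n
      unfolding l_def using that by (intro cINF_lower[OF bdd]) auto
    with \<open>y < l\<close> show "\<forall>\<^sub>F n in sequentially. y < a n / n"
      by (intro eventually_sequentiallyI[of 1]) (auto intro: less_le_trans)
  next
    fix y assume "l < y"
    then obtain k where k: "k > 0" "a k / k < y"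
      unfolding l_def by (subst (asm) cINF_less_iff[OF _ bdd]) auto
    have "(\<lambda>n. a k / k + (MAX i\<in>{..<k}. a i) / real n) \<longlonglongrightarrow> a k / k + 0"
      by (intro tendsto_intros lim_const_over_n)
    then have "\<forall>\<^sub>F n in sequentially. a k / k + (MAX i\<in>{..<k}. a i) / real n < y"
      using k by (intro order_tendstoD) simp_all
    then show "\<forall>\<^sub>F n in sequentially. a n / n < y"
      by eventually_elim (use subadditive_le[OF sub nn k(1)] in \<open>auto intro: le_less_trans\<close>)
  qed
  then show ?thesis by (rule convergentI)
qed

section \<open>Names of orbits\<close>

lemma simple_function_map_upt:
  assumes "\<And>i. i < n \<Longrightarrow> simple_function M (X i)"
  shows "simple_function M (\<lambda>x. map (\<lambda>i. X i x) [0..<n])"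
  using assms
proof (induction n)
  case 0
  then show ?case by (simp add: simple_function_const)
next
  case (Suc n)
  have "simple_function M (\<lambda>x. (map (\<lambda>i. X i x) [0..<n], X n x))"
    using Suc by (intro simple_function_Pair) auto
  then show ?case
    by (rule simple_function_factor[where f = "\<lambda>(xs, v). xs @ [v]"]) simp
qed

definition name :: "('a \<Rightarrow> 'a) \<Rightarrow> ('a \<Rightarrow> 'b) \<Rightarrow> nat \<Rightarrow> 'a \<Rightarrow> 'b list" where
  "name T X n x = map (\<lambda>k. X ((T ^^ k) x)) [0..<n]"

lemma length_name [simp]: "length (name T X n x) = n"
  by (simp add: name_def)

lemma nth_name [simp]: "k < n \<Longrightarrow> name T X n x ! k = X ((T ^^ k) x)"
  by (simp add: name_def)

context mt_dynamical_system
begin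


abbreviation S :: "'a \<Rightarrow> 'a" where "S \<equiv> inv_into (space M) T"

lemma measurable_pow [measurable]: "(T ^^ k) \<in> measurable M M" "(S ^^ k) \<in> measurable M M"
  using measurable_compose_n T_measurable T_inv_measurable by auto

lemma space_pow [simp]: "x \<in> space M \<Longrightarrow> (T ^^ k) x \<in> space M" "x \<in> space M \<Longrightarrow> (S ^^ k) x \<in> space M"
  using measurable_pow[THEN measurable_space] by auto

lemma T_S [simp]: "x \<in> space M \<Longrightarrow> T (S x) = x"
  using T_bij by (auto simp: bij_betw_def f_inv_into_f)

lemma S_T [simp]: "x \<in> space M \<Longrightarrow> S (T x) = x"
  using T_bij by (auto simp: bij_betw_def inv_into_f_f)

lemma S_pow_T_pow:
  assumes x: "x \<in> space M" shows "i \<le> k \<Longrightarrow> (S ^^ i) ((T ^^ k) x) = (T ^^ (k - i)) x"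
proof (induction i)
  case (Suc i)
  then have "(T ^^ (k - i)) x = T ((T ^^ (k - Suc i)) x)"
    by (simp add: Suc_diff_Suc flip: funpow.simps(2)[unfolded comp_def, THEN fun_cong])
  with Suc x show ?case by simp
qed simp

lemma T_pow_S_pow:
  assumes x: "x \<in> space M" shows "i \<le> k \<Longrightarrow> (T ^^ i) ((S ^^ k) x) = (S ^^ (k - i)) x"
proof (induction i)
  case (Suc i)
  then have "(S ^^ (k - i)) x = S ((S ^^ (k - Suc i)) x)"
    by (simp add: Suc_diff_Suc flip: funpow.simps(2)[unfolded comp_def, THEN fun_cong])
  with Suc x show ?case by simp
qed simp

lemma prob_vimage_pow:
  assumes A: "A \<in> events" shows "prob ((T ^^ k) -` A \<inter> space M) = prob A"
proof (induction k)
  case 0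
  with sets.sets_into_space[OF A] show ?case by (simp add: Int_absorb2)
next
  case (Suc k)
  have B: "(T ^^ k) -` A \<inter> space M \<in> events"
    using measurable_sets[OF measurable_pow(1) A] .
  have "(T ^^ Suc k) -` A \<inter> space M = T -` ((T ^^ k) -` A \<inter> space M) \<inter> space M"
    using space_pow(1)[of _ 1] by (auto simp: funpow_swap1)
  also have "prob \<dots> = measure (distr M M T) ((T ^^ k) -` A \<inter> space M)"
    using B by (simp add: measure_distr T_measurable)
  also have "\<dots> = prob A" using Suc by (simp add: T_preserving)
  finally show ?case .
qed

lemma T_pow_surj:
  assumes "y \<in> space M" obtains x where "x \<in> space M" "(T ^^ k) x = y"
  using T_pow_S_pow[OF assms, of k k] assms by (intro that[of "(S ^^ k) y"]) auto

lemma simple_function_pow: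
  assumes "simple_function M X" shows "simple_function M (\<lambda>x. X ((T ^^ k) x))"
  using simple_function_comp[OF measurable_pow(1) assms] by (simp add: comp_def)

text \<open>The power of \<open>T\<close> is onto and preserves the measure, so \<open>X\<close> keeps its values and its distribution.\<close>

lemma sf_entropy_pow:
  assumes X: "simple_function M X"
  shows "sf_entropy M (\<lambda>x. X ((T ^^ k) x)) = sf_entropy M X"
proof -
  have im: "(\<lambda>x. X ((T ^^ k) x)) ` space M = X ` space M"
  proof (intro set_eqI iffI)
    fix v assume "v \<in> X ` space M"
    then obtain y where "y \<in> space M" "v = X y" by blast
    then show "v \<in> (\<lambda>x. X ((T ^^ k) x)) ` space M"
      using T_pow_surj[of y k] by (metis image_eqI)
  qed auto
  have "(\<lambda>x. X ((T ^^ k) x)) -` {v} \<inter> space M = (T ^^ k) -` (X -` {v} \<inter> space M) \<inter> space M" for v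
    by auto
  then have "prob ((\<lambda>x. X ((T ^^ k) x)) -` {v} \<inter> space M) = prob (X -` {v} \<inter> space M)" for v
    using prob_vimage_pow[OF simple_functionD(2)[OF X], of k "{v}"] by (simp only:)
  then show ?thesis unfolding sf_entropy_def im by simp
qed

lemma name_Suc: "name T X (Suc n) x = name T X n x @ [X ((T ^^ n) x)]"
  by (simp add: name_def)

lemma simple_function_name:
  assumes "simple_function M X" shows "simple_function M (name T X n)"
  unfolding name_def[abs_def] by (intro simple_function_map_upt simple_function_pow assms)

lemma sf_entropy_name_le:
  assumes X: "simple_function M X" shows "sf_entropy M (name T X n) \<le> n * sf_entropy M X"
proof (induction n)
  case 0
  have "sf_entropy M (name T X 0) \<le> ln (card {[] :: 'b list})"
    by (rule sf_entropy_le_card[OF simple_function_name[OF X]]) (auto simp: name_def)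
  then show ?case by simp
next
  case (Suc n)
  note sf = simple_function_name[OF X, of n] simple_function_pow[OF X, of n]
  have "sf_entropy M (name T X (Suc n)) \<le> sf_entropy M (\<lambda>x. (name T X n x, X ((T ^^ n) x)))"
    by (rule sf_entropy_factor_le[OF simple_function_Pair[OF sf], where f = "\<lambda>(xs, v). xs @ [v]"])
      (simp add: name_Suc)
  also have "\<dots> \<le> sf_entropy M (name T X n) + sf_entropy M X"
    using sf_entropy_Pair_le[OF sf] sf_entropy_pow[OF X] by simp
  finally show ?case using Suc by (simp add: algebra_simps)
qed

section \<open>Iterated joins\<close>

lemma cover_pullback:
  assumes "cover M \<U>" shows "cover M (pullback M T k \<U>)"
proof -
  have "\<Union>(pullback M T k \<U>) = (T ^^ k) -` \<Union>\<U> \<inter> space M"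
    by (auto simp: pullback_def)
  also have "\<dots> = space M" using assms by (auto simp: cover_def)
  finally show ?thesis
    using assms by (auto simp: cover_def pullback_def intro!: measurable_sets[OF measurable_pow(1)])
qed

lemma mpartition_pullback:
  assumes "mpartition M \<alpha>" shows "mpartition M (pullback M T k \<alpha>)"
proof -
  have "disjoint (pullback M T k \<alpha>)"
    using assms unfolding mpartition_def disjoint_def pullback_def by blast
  then show ?thesis using assms cover_pullback by (auto simp: mpartition_def)
qed

lemma cover_space: "cover M {space M}"
  by (simp add: cover_def)

lemma cover_iterated_join: "cover M \<U> \<Longrightarrow> cover M (iterated_join M T \<U> n)"
  by (induction n) (simp_all add: cover_space cover_join cover_pullback)

lemma mpartition_space: "mpartition M {space M}"
  by (simp add: mpartition_def cover_space)

lemma mpartition_iterated_join: "mpartition M \<alpha> \<Longrightarrow> mpartition M (iterated_join M T \<alpha> n)"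
  by (induction n) (simp_all add: mpartition_space mpartition_join mpartition_pullback)

lemma finer_pullback: "finer \<U> \<V> \<Longrightarrow> finer (pullback M T k \<U>) (pullback M T k \<V>)"
  unfolding finer_def pullback_def by (simp add: image_iff) (meson le_infI1 vimage_mono)

lemma finer_iterated_join:
  "finer \<U> \<V> \<Longrightarrow> finer (iterated_join M T \<U> n) (iterated_join M T \<V> n)"
  by (induction n) (simp_all add: finer_refl finer_join finer_pullback)

lemma join_space:
  assumes "cover M \<U>" shows "join \<U> {space M} = \<U>"
proof -
  have "U \<inter> space M = U" if "U \<in> \<U>" for U
    using that assms by (auto simp: cover_def)
  then show ?thesis unfolding join_def by auto
qed

lemma join_assoc: "join (join \<U> \<V>) \<W> = join \<U> (join \<V> \<W>)"
  unfolding join_def by (auto simp: Int_assoc) (metis Int_assoc)+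

lemma pullback_join: "pullback M T k (join \<U> \<V>) = join (pullback M T k \<U>) (pullback M T k \<V>)"
proof -
  have "(T ^^ k) -` (U \<inter> V) \<inter> space M = ((T ^^ k) -` U \<inter> space M) \<inter> ((T ^^ k) -` V \<inter> space M)" for U V
    by auto
  then show ?thesis unfolding pullback_def join_def by (auto simp: image_def) metis+
qed

lemma pullback_pullback: "pullback M T m (pullback M T n \<U>) = pullback M T (m + n) \<U>"
proof -
  have "(T ^^ m) -` ((T ^^ n) -` U \<inter> space M) \<inter> space M = (T ^^ (m + n)) -` U \<inter> space M" for U
    by (auto simp: funpow_add add.commute[of m n])
  then show ?thesis by (simp add: pullback_def image_image)
qed

text \<open>The cocycle identity behind the subadditivity of the entropies of iterated joins.\<close>

lemma iterated_join_add:
  assumes "cover M \<U>"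
  shows "iterated_join M T \<U> (m + n) =
    join (iterated_join M T \<U> m) (pullback M T m (iterated_join M T \<U> n))"
proof (induction n)
  case 0
  have "pullback M T m {space M} = {space M}" by (auto simp: pullback_def)
  then show ?case using join_space[OF cover_iterated_join[OF assms]] by simp
next
  case (Suc n)
  then show ?case by (simp add: join_assoc pullback_join pullback_pullback)
qed

lemma partition_entropy_pullback_le:
  assumes a: "mpartition M \<alpha>"
  shows "partition_entropy M (pullback M T k \<alpha>) \<le> partition_entropy M \<alpha>"
proof -
  note sf = simple_function_cell[OF a]
  have "sf_entropy M (cell (pullback M T k \<alpha>)) \<le> sf_entropy M (\<lambda>x. cell \<alpha> ((T ^^ k) x))"
  proof (rule sf_entropy_factor_le[OF simple_function_pow[OF sf], where f = "\<lambda>A. (T ^^ k) -` A \<inter> space M"])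
    fix x assume "x \<in> space M"
    then show "cell (pullback M T k \<alpha>) x = (T ^^ k) -` (cell \<alpha> ((T ^^ k) x)) \<inter> space M"
      using cell_in[OF a, of "(T ^^ k) x"]
      by (intro cell_eq[OF mpartition_pullback[OF a]]) (auto simp: pullback_def)
  qed
  then show ?thesis
    using a sf_entropy_pow[OF sf] by (simp add: partition_entropy_eq mpartition_pullback)
qed

lemma cover_entropy_pullback_le:
  assumes "cover M \<U>" shows "cover_entropy M (pullback M T k \<U>) \<le> cover_entropy M \<U>"
proof (rule cover_entropy_greatest[OF assms])
  fix \<alpha> assume "mpartition M \<alpha>" "finer \<alpha> \<U>"
  then show "cover_entropy M (pullback M T k \<U>) \<le> partition_entropy M \<alpha>"
    using cover_entropy_le[OF mpartition_pullback finer_pullback] partition_entropy_pullback_le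
    by (meson order_trans)
qed

lemma cover_entropy_nonneg: "cover M \<U> \<Longrightarrow> 0 \<le> cover_entropy M \<U>"
  by (rule cover_entropy_greatest) (auto intro: partition_entropy_nonneg)

lemma h_minus_LIMSEQ:
  assumes "cover M \<U>"
  shows "(\<lambda>n. cover_entropy M (iterated_join M T \<U> n) / n) \<longlonglongrightarrow> h_minus M T \<U>"
proof -
  have "convergent (\<lambda>n. cover_entropy M (iterated_join M T \<U> n) / n)"
  proof (rule subadditive_convergent)
    fix m n
    note c = cover_iterated_join[OF assms]
    show "0 \<le> cover_entropy M (iterated_join M T \<U> n)"
      by (rule cover_entropy_nonneg[OF c])
    show "cover_entropy M (iterated_join M T \<U> (m + n))
        \<le> cover_entropy M (iterated_join M T \<U> m) + cover_entropy M (iterated_join M T \<U> n)"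
      unfolding iterated_join_add[OF assms]
      using cover_entropy_join_le[OF c cover_pullback[OF c]] cover_entropy_pullback_le[OF c]
      by (meson add_left_mono order_trans)
  qed
  then show ?thesis unfolding h_minus_def by (rule convergent_LIMSEQ_iff[THEN iffD1])
qed

text \<open>No partition finer than a partition has smaller entropy, so the infimum in \<open>cover_entropy\<close> is attained by
  the partition itself.\<close>

lemma ks_entropy_eq_h_minus: "mpartition M \<alpha> \<Longrightarrow> ks_entropy M T \<alpha> = h_minus M T \<alpha>"
  by (simp add: ks_entropy_def h_minus_def cover_entropy_partition mpartition_iterated_join)

lemma ks_entropy_LIMSEQ:
  assumes "mpartition M \<alpha>"
  shows "(\<lambda>n. partition_entropy M (iterated_join M T \<alpha> n) / n) \<longlonglongrightarrow> ks_entropy M T \<alpha>"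
proof -
  from assms have "cover M \<alpha>" by (simp add: mpartition_def)
  from h_minus_LIMSEQ[OF this] assms show ?thesis
    by (simp add: ks_entropy_eq_h_minus cover_entropy_partition mpartition_iterated_join)
qed

lemma h_minus_le_ks_entropy:
  assumes U: "cover M \<U>" and a: "mpartition M \<alpha>" and fin: "finer \<alpha> \<U>"
  shows "h_minus M T \<U> \<le> ks_entropy M T \<alpha>"
  by (rule LIMSEQ_le[OF h_minus_LIMSEQ[OF U] ks_entropy_LIMSEQ[OF a]])
    (auto intro!: divide_right_mono cover_entropy_le mpartition_iterated_join a finer_iterated_join fin)

lemma h_minus_le_h_plus: 
  assumes U: "cover M \<U>"
  shows "h_minus M T \<U> \<le> h_plus M T \<U>"
  unfolding h_plus_def
  by (rule cINF_greatest[OF finer_partitions_nonempty[OF U]]) (simp add: h_minus_le_ks_entropy[OF U])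

lemma h_plus_le:
  assumes U: "cover M \<U>" and a: "mpartition M \<alpha>" and fin: "finer \<alpha> \<U>"
  shows "h_plus M T \<U> \<le> ks_entropy M T \<alpha>"
  unfolding h_plus_def
proof (rule cINF_lower)
  show "bdd_below (ks_entropy M T ` {\<alpha>. mpartition M \<alpha> \<and> finer \<alpha> \<U>})"
    by (rule bdd_belowI2[of _ "h_minus M T \<U>"]) (simp add: h_minus_le_ks_entropy[OF U])
qed (use a fin in simp)

text \<open>A member of the join over \<open>n\<close> times is an intersection of preimages of members of \<open>\<U>\<close>; \<open>s\<close> lists these members.\<close>

lemma iterated_join_itinerary:
  "A \<in> iterated_join M T \<U> n \<Longrightarrow>
    \<exists>s. \<forall>i<n. s i \<in> \<U> \<and> A \<subseteq> (T ^^ i) -` s i"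
proof (induction n arbitrary: A)
  case (Suc n)
  then obtain B U where B: "B \<in> iterated_join M T \<U> n" "U \<in> \<U>"
      "A = B \<inter> ((T ^^ n) -` U \<inter> space M)"
    by (auto simp: join_def pullback_def)
  from Suc.IH[OF B(1)] obtain s where s: "\<forall>i<n. s i \<in> \<U> \<and> B \<subseteq> (T ^^ i) -` s i" by blast
  have "\<forall>i<Suc n. (s(n := U)) i \<in> \<U> \<and> A \<subseteq> (T ^^ i) -` ((s(n := U)) i)"
  proof (intro allI impI)
    fix i assume "i < Suc n"
    then show "(s(n := U)) i \<in> \<U> \<and> A \<subseteq> (T ^^ i) -` ((s(n := U)) i)"
      using s B(2,3) by (cases "i = n") (auto simp: less_Suc_eq)
  qed
  then show ?case by blast
qed simp

lemma cell_iterated_join: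
  assumes a: "mpartition M \<alpha>" and x: "x \<in> space M"
  shows "cell (iterated_join M T \<alpha> n) x = {y\<in>space M. \<forall>k<n. (T ^^ k) y \<in> cell \<alpha> ((T ^^ k) x)}"
proof (induction n)
  case 0
  show ?case using x by (simp add: cell_eq[OF mpartition_space])
next
  case (Suc n)
  have "cell (pullback M T n \<alpha>) x = (T ^^ n) -` cell \<alpha> ((T ^^ n) x) \<inter> space M"
    using cell_in[OF a, of "(T ^^ n) x"] x
    by (intro cell_eq[OF mpartition_pullback[OF a]]) (auto simp: pullback_def)
  then show ?case
    using Suc cell_join[OF mpartition_iterated_join[OF a] mpartition_pullback[OF a] x]
    by (auto simp: less_Suc_eq)
qed

text \<open>If the atom of \<open>\<alpha>\<close> can be read off the value of \<open>X\<close>, then the atom of the iterated join can be read off the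
  name with respect to \<open>X\<close>.\<close>

lemma partition_entropy_iterated_join_le:
  assumes a: "mpartition M \<alpha>" and X: "simple_function M X"
    and cell: "\<And>x. x \<in> space M \<Longrightarrow> cell \<alpha> x = f (X x)"
  shows "partition_entropy M (iterated_join M T \<alpha> n) \<le> sf_entropy M (name T X n)"
proof -
  have "sf_entropy M (cell (iterated_join M T \<alpha> n)) \<le> sf_entropy M (name T X n)"
    by (rule sf_entropy_factor_le[OF simple_function_name[OF X],
          where f = "\<lambda>xs. {y\<in>space M. \<forall>k<n. (T ^^ k) y \<in> f (xs ! k)}"])
      (simp add: cell_iterated_join[OF a] cell)
  then show ?thesis by (simp add: partition_entropy_eq mpartition_iterated_join a)
qed

section \<open>Marker sets\<close>

definition short_periodic :: "nat \<Rightarrow> 'a set" where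
  "short_periodic L = {x\<in>space M. \<exists>p\<in>{1..<L}. (T ^^ p) x = x}"

text \<open>The use of the standard structure: such a function makes coincidences of points measurable, and
  the preimages of rational intervals form a countable family that separates points.\<close>

lemma separating_function:
  obtains f :: "'a \<Rightarrow> real" where "f \<in> borel_measurable M" "inj_on f (space M)"
proof -
  obtain f and g where f: "f \<in> measurable M (restrict_space borel {0..1::real})"
    and gf: "\<forall>x\<in>space M. g (f x) = x"
    using standard unfolding measurable_isomorphic_def by blast
  have "inj_on f (space M)" using gf by (metis inj_onI)
  with f show ?thesis by (intro that) (auto simp: measurable_restrict_space2_iff)
qed

lemma pow_inj: "x \<in> space M \<Longrightarrow> y \<in> space M \<Longrightarrow> (T ^^ k) x = (T ^^ k) y \<longleftrightarrow> x = y"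
  by (metis S_pow_T_pow diff_self_eq_0 funpow_0 order_refl)

lemma T_pow_add: "(T ^^ i) ((T ^^ j) x) = (T ^^ (i + j)) x"
  by (simp add: funpow_add)

lemma sets_short_periodic [measurable]: "short_periodic L \<in> sets M"
proof -
  obtain f :: "'a \<Rightarrow> real" where f [measurable]: "f \<in> borel_measurable M" and inj: "inj_on f (space M)"
    using separating_function .
  have "short_periodic L = {x\<in>space M. \<exists>p\<in>{1..<L}. f ((T ^^ p) x) = f x}"
    unfolding short_periodic_def using inj_onD[OF inj] space_pow(1) by metis
  also have "\<dots> \<in> sets M" by measurable
  finally show ?thesis .
qed

lemma short_periodic_pow_iff:
  assumes "x \<in> space M" shows "(T ^^ k) x \<in> short_periodic L \<longleftrightarrow> x \<in> short_periodic L"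
proof -
  have "(T ^^ p) ((T ^^ k) x) = (T ^^ k) x \<longleftrightarrow> (T ^^ p) x = x" for p
    using pow_inj[of "(T ^^ p) x" x k] assms by (simp add: T_pow_add add.commute)
  then show ?thesis using assms by (simp add: short_periodic_def)
qed

text \<open>Every \<open>p\<close> with \<open>1 \<le> p < L\<close> divides \<open>L!\<close>, which makes \<open>L!\<close> a common period.\<close>

lemma short_periodic_fact:
  assumes x: "x \<in> short_periodic L" shows "(T ^^ (k mod fact L)) x = (T ^^ k) x"
proof -
  from x obtain p where p: "1 \<le> p" "p < L" "(T ^^ p) x = x" by (auto simp: short_periodic_def)
  have mod: "(T ^^ (j mod p)) x = (T ^^ j) x" for j
    using funpow_mod_eq[OF p(3)] .
  have "p dvd fact L" using p by (intro dvd_fact) auto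
  then have "k mod fact L mod p = k mod p" by (rule mod_mod_cancel)
  then show ?thesis using mod by metis
qed

text \<open>The preimages of \<open>A\<close> under the first \<open>L\<close> powers of \<open>T\<close> are disjoint and all have the measure of \<open>A\<close>.\<close>

lemma disjoint_vimages_bound:
  fixes L :: nat
  assumes A: "A \<in> events" and sep: "\<And>x i. x \<in> A \<Longrightarrow> 1 \<le> i \<Longrightarrow> i < L \<Longrightarrow> (T ^^ i) x \<notin> A"
  shows "L * prob A \<le> 1"
proof -
  let ?V = "\<lambda>i. (T ^^ i) -` A \<inter> space M"
  have V: "?V i \<in> events" for i using measurable_sets[OF measurable_pow(1) A] .
  have disj: "?V i \<inter> ?V j = {}" if "i < j" "j < L" for i j
  proof (rule ccontr)
    assume "?V i \<inter> ?V j \<noteq> {}"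
    then obtain x where "(T ^^ i) x \<in> A" "(T ^^ j) x \<in> A" by blast
    moreover have "(T ^^ j) x = (T ^^ (j - i)) ((T ^^ i) x)"
      using that by (simp add: T_pow_add)
    ultimately show False using sep[of "(T ^^ i) x" "j - i"] that by auto
  qed
  have "disjoint_family_on ?V {..<L}"
    unfolding disjoint_family_on_def
  proof (intro ballI impI)
    fix i j assume "i \<in> {..<L}" "j \<in> {..<L}" "i \<noteq> j"
    then show "?V i \<inter> ?V j = {}" using disj[of i j] disj[of j i] by (cases "i < j") auto
  qed
  then have "(\<Sum>i<L. prob (?V i)) = prob (\<Union>i<L. ?V i)"
    using V by (intro finite_measure_finite_Union[symmetric]) auto
  also have "\<dots> \<le> 1" by simp
  finally show ?thesis by (simp add: prob_vimage_pow[OF A])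
qed

text \<open>Stage \<open>m\<close> adds those points of \<open>C m\<close> that are at distance at least \<open>L\<close>, along their orbit and in both directions, from
  everything selected before. If each \<open>C m\<close> is separated from its own translates, then so is the union of all stages, and
  it is maximal: a rejected point has a selected point within distance less than \<open>L\<close> on its orbit.\<close>

fun greedy :: "nat \<Rightarrow> (nat \<Rightarrow> 'a set) \<Rightarrow> nat \<Rightarrow> 'a set" where
  "greedy L C 0 = {}"
| "greedy L C (Suc m) = greedy L C m \<union>
     {x\<in>C m. \<forall>i<L. (T ^^ i) x \<notin> greedy L C m \<and> (S ^^ i) x \<notin> greedy L C m}"

lemma sets_greedy:
  assumes [measurable]: "\<And>m. C m \<in> sets M" shows "greedy L C m \<in> sets M"
proof (induction m)
  case (Suc m)
  note [measurable] = Suc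
  have "{x\<in>C m. \<forall>i<L. (T ^^ i) x \<notin> greedy L C m \<and> (S ^^ i) x \<notin> greedy L C m} =
     C m \<inter> {x\<in>space M. \<forall>i\<in>{..<L}. (T ^^ i) x \<notin> greedy L C m \<and> (S ^^ i) x \<notin> greedy L C m}"
    using sets.sets_into_space[OF assms] by auto
  also have "\<dots> \<in> sets M" by measurable
  finally show ?case using Suc by simp
qed simp

lemma greedy_separated:
  assumes sep: "\<And>m x i. x \<in> C m \<Longrightarrow> 1 \<le> i \<Longrightarrow> i < L \<Longrightarrow> (T ^^ i) x \<notin> C m"
    and C: "\<And>m. C m \<subseteq> space M"
  shows "x \<in> greedy L C m \<Longrightarrow> 1 \<le> i \<Longrightarrow> i < L \<Longrightarrow> (T ^^ i) x \<notin> greedy L C m"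
proof (induction m)
  case (Suc m)
  have sub: "greedy L C m \<subseteq> space M" for m
    by (induction m) (use C in auto)
  have x: "x \<in> space M" using Suc.prems(1) sub by blast
  show ?case
  proof
    assume T: "(T ^^ i) x \<in> greedy L C (Suc m)"
    have "(S ^^ i) ((T ^^ i) x) = x" using S_pow_T_pow[OF x, of i i] by simp
    then show False
      using T Suc sep[of x m i] by auto
  qed
qed simp

lemma greedy_mono: "m \<le> n \<Longrightarrow> greedy L C m \<subseteq> greedy L C n"
  by (rule lift_Suc_mono_le[of "greedy L C"]) auto

text \<open>The sets \<open>C m\<close> are indexed by rational intervals: \<open>x\<close> lies in \<open>C m\<close> if \<open>f x\<close> is in the interval and the next \<open>L - 1\<close>
  points of the orbit have their values outside. A point without period below \<open>L\<close> differs from its next \<open>L - 1\<close> iterates,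
  and an interval around \<open>f x\<close> small enough to avoid their values witnesses that \<open>x\<close> is covered.\<close>

lemma marker_set:
  fixes L :: nat
  obtains E where "E \<in> sets M" "L * prob E \<le> 1"
    "\<And>x. x \<in> space M - short_periodic L \<Longrightarrow> \<exists>i. (T ^^ i) x \<in> E"
proof -
  obtain f :: "'a \<Rightarrow> real" where f [measurable]: "f \<in> borel_measurable M" and inj: "inj_on f (space M)"
    using separating_function .
  define C where "C m = (case from_nat m of (q, r) \<Rightarrow>
      {x\<in>space M. f x \<in> {of_rat q<..<of_rat r} \<and>
         (\<forall>i\<in>{1..<L}. f ((T ^^ i) x) \<notin> {of_rat q<..<of_rat r})})" for m
  have C_sets: "C m \<in> sets M" for m
    unfolding C_def by (cases "from_nat m :: rat \<times> rat") simp
  have C_space: "C m \<subseteq> space M" for m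
    using sets.sets_into_space[OF C_sets] .
  have C_sep: "(T ^^ i) x \<notin> C m" if "x \<in> C m" "1 \<le> i" "i < L" for m x i
    using that unfolding C_def by (cases "from_nat m :: rat \<times> rat") auto
  have C_cover: "\<exists>m. x \<in> C m" if x: "x \<in> space M - short_periodic L" for x
  proof -
    let ?F = "(\<lambda>i. f ((T ^^ i) x)) ` {1..<L}"
    have "f x \<notin> ?F"
    proof
      assume "f x \<in> ?F"
      then obtain i where i: "i \<in> {1..<L}" "f ((T ^^ i) x) = f x" by force
      from x have "(T ^^ i) x = x" by (intro inj_onD[OF inj i(2)]) auto
      with i(1) x show False by (auto simp: short_periodic_def)
    qed
    moreover have "open (- ?F)"
      by (intro open_Compl finite_imp_closed) simp
    ultimately obtain e where e: "e > 0" "ball (f x) e \<subseteq> - ?F"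
      using openE[of "- ?F" "f x"] by blast
    obtain q where q: "f x - e < of_rat q" "of_rat q < f x"
      using of_rat_dense[of "f x - e" "f x"] e by auto
    obtain r where r: "f x < of_rat r" "of_rat r < f x + e"
      using of_rat_dense[of "f x" "f x + e"] e by auto
    have "{of_rat q<..<of_rat r} \<subseteq> ball (f x) e"
      using q r by (auto simp: dist_real_def)
    with e(2) have "\<forall>i\<in>{1..<L}. f ((T ^^ i) x) \<notin> {of_rat q<..<of_rat r}" by blast
    then have "x \<in> C (to_nat (q, r))"
      using x q r by (simp add: C_def)
    then show ?thesis ..
  qed
  define E where "E = (\<Union>m. greedy L C m)"
  have E_sets: "E \<in> sets M"
    unfolding E_def using sets_greedy[OF C_sets] by auto
  have "(T ^^ i) x \<notin> E" if x: "x \<in> E" and i: "1 \<le> i" "i < L" for x i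
  proof
    assume "(T ^^ i) x \<in> E"
    with x obtain m n where mn: "x \<in> greedy L C m" "(T ^^ i) x \<in> greedy L C n"
      unfolding E_def by blast
    have "x \<in> greedy L C (max m n)" "(T ^^ i) x \<in> greedy L C (max m n)"
      using mn greedy_mono[of m "max m n" L C] greedy_mono[of n "max m n" L C] by auto
    moreover have "(T ^^ i) x \<notin> greedy L C (max m n)" if "x \<in> greedy L C (max m n)"
      using C_sep C_space that i by (rule greedy_separated)
    ultimately show False by blast
  qed
  with E_sets have E_prob: "L * prob E \<le> 1" by (rule disjoint_vimages_bound)
  have "\<exists>i. (T ^^ i) x \<in> E" if x: "x \<in> space M - short_periodic L" for x
  proof -
    \<comment> \<open>Maximality yields a selected point at distance less than \<open>L\<close> in an unknown direction; starting from
      \<open>T\<^sup>L x\<close> puts that point in the future of \<open>x\<close>.\<close>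
    let ?y = "(T ^^ L) x"
    have "?y \<in> space M - short_periodic L" using x by (simp add: short_periodic_pow_iff)
    then obtain m where m: "?y \<in> C m" using C_cover by blast
    show ?thesis
    proof (cases "?y \<in> greedy L C (Suc m)")
      case True
      then show ?thesis unfolding E_def by blast
    next
      case False
      with m obtain i where i: "i < L" "(T ^^ i) ?y \<in> greedy L C m \<or> (S ^^ i) ?y \<in> greedy L C m"
        by auto
      have "(T ^^ i) ?y = (T ^^ (i + L)) x" "(S ^^ i) ?y = (T ^^ (L - i)) x"
        using x i(1) by (simp_all add: T_pow_add S_pow_T_pow)
      with i(2) show ?thesis unfolding E_def by auto
    qed
  qed
  with E_sets E_prob show ?thesis using that by blast
qed

section \<open>Block codes\<close>

lemma prob_inverse_pow:
  assumes E: "E \<in> events" shows "prob {x\<in>space M. (S ^^ i) x \<in> E} = prob E"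
proof -
  let ?A = "{x\<in>space M. (S ^^ i) x \<in> E}"
  have A: "?A \<in> events" using E by measurable
  have "(T ^^ i) -` ?A \<inter> space M = E"
    using sets.sets_into_space[OF E] S_pow_T_pow[of _ i i] by auto
  with prob_vimage_pow[OF A, of i] show ?thesis by simp
qed

text \<open>A phase function \<open>\<kappa>\<close>, whose value \<open>j < N\<close> marks the first points of blocks for the \<open>j\<close>-th way of cutting. With
  \<open>\<tau> x\<close> the time until the next visit to a marker set, \<open>\<kappa> x\<close> is \<open>\<tau> x mod N\<close> when at least \<open>N\<close> steps are left, and
  the default value \<open>N\<close> otherwise. For each \<open>j\<close>, a point outside the blocks must have a visit to the marker
  set fewer than \<open>N\<close> steps ahead or behind; there are \<open>2 * N\<close> such times, and the marker set has measure at most \<open>1/L\<close>.\<close>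

lemma block_positions:
  fixes N L :: nat
  assumes N: "0 < N"
  obtains \<kappa> :: "'a \<Rightarrow> nat" where "simple_function M \<kappa>" "\<And>x. \<kappa> x \<le> N"
    "\<And>x. x \<in> short_periodic L \<Longrightarrow> \<kappa> x = N"
    "\<And>j. j < N \<Longrightarrow> L * prob {x\<in>space M - short_periodic L. \<forall>i<N. \<kappa> ((S ^^ i) x) \<noteq> j} \<le> 2 * N"
proof -
  obtain E where E [measurable]: "E \<in> events" and E_prob: "L * prob E \<le> 1"
    and hit: "\<And>x. x \<in> space M - short_periodic L \<Longrightarrow> \<exists>i. (T ^^ i) x \<in> E"
    using marker_set[of L] by metis
  define \<tau> where "\<tau> x = (LEAST i. (T ^^ i) x \<in> E)" for x
  define \<kappa> where "\<kappa> x = (if x \<in> space M - short_periodic L \<and> N \<le> \<tau> x then \<tau> x mod N else N)" for x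
  have [measurable]: "\<tau> \<in> measurable M (count_space UNIV)"
    unfolding \<tau>_def by measurable
  have le: "\<kappa> x \<le> N" for x
    using mod_less_divisor[OF N, of "\<tau> x"] by (simp add: \<kappa>_def less_imp_le)
  have "\<kappa> \<in> measurable M (count_space UNIV)"
    unfolding \<kappa>_def by measurable
  moreover have "finite (\<kappa> ` space M)"
    using le by (intro finite_subset[of "\<kappa> ` space M" "{..N}"]) auto
  ultimately have simple: "simple_function M \<kappa>"
    by (simp add: simple_function_eq_measurable)
  have bound: "L * prob {x\<in>space M - short_periodic L. \<forall>i<N. \<kappa> ((S ^^ i) x) \<noteq> j} \<le> 2 * N" (is "L * prob ?R \<le> _")
    if j: "j < N" for j
  proof -
    \<comment> \<open>Going back in time without meeting the marker set makes the countdown longer, one step at a time.\<close>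
    have shift: "\<tau> ((S ^^ i) x) = \<tau> x + i"
      if x: "x \<in> space M - short_periodic L" and i: "i < N" and past: "\<forall>i<N. (S ^^ i) x \<notin> E" for x i
      unfolding \<tau>_def[of "(S ^^ i) x"]
    proof (rule Least_equality)
      have 1: "(T ^^ i) ((S ^^ i) x) = x" using x T_pow_S_pow[of x i i] by simp
      have 2: "(T ^^ (k + i)) ((S ^^ i) x) = (T ^^ k) x" for k
        using 1 by (simp flip: T_pow_add)
      show "(T ^^ (\<tau> x + i)) ((S ^^ i) x) \<in> E"
        unfolding 2 using LeastI_ex[OF hit[OF x]] by (simp add: \<tau>_def)
      fix y assume y: "(T ^^ y) ((S ^^ i) x) \<in> E"
      show "\<tau> x + i \<le> y"
      proof (cases "y < i")
        case True
        then have "(T ^^ y) ((S ^^ i) x) = (S ^^ (i - y)) x" "i - y < N"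
          using x i T_pow_S_pow[of x y i] by auto
        with y past show ?thesis by auto
      next
        case False
        then have "(T ^^ (y - i)) x \<in> E" using y 2[of "y - i"] by simp
        then have "\<tau> x \<le> y - i" unfolding \<tau>_def by (rule Least_le)
        with False show ?thesis by simp
      qed
    qed
    let ?F = "\<lambda>i. (T ^^ i) -` E \<inter> space M" and ?B = "\<lambda>i. {x\<in>space M. (S ^^ i) x \<in> E}"
    have "?R \<subseteq> (\<Union>i<N. ?F i) \<union> (\<Union>i<N. ?B i)"
    proof
      fix x assume R: "x \<in> ?R"
      then have x: "x \<in> space M - short_periodic L" by simp
      show "x \<in> (\<Union>i<N. ?F i) \<union> (\<Union>i<N. ?B i)"
      proof (rule ccontr)
        assume "\<not> ?thesis"
        with x have fut: "\<forall>i<N. (T ^^ i) x \<notin> E" and past: "\<forall>i<N. (S ^^ i) x \<notin> E" by auto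
        have "(T ^^ \<tau> x) x \<in> E"
          using LeastI_ex[OF hit[OF x]] by (simp add: \<tau>_def)
        with fut have N_le: "N \<le> \<tau> x" by (metis not_le)
        \<comment> \<open>The number of steps back after which the countdown has residue \<open>j\<close>; adding \<open>N\<close> keeps the subtraction of
          natural numbers from truncating.\<close>
        define i where "i = (j + N - \<tau> x mod N) mod N"
        have i: "i < N" using N by (simp add: i_def)
        have "(\<tau> x + i) mod N = (\<tau> x mod N + (j + N - \<tau> x mod N)) mod N"
          unfolding i_def by (simp add: mod_simps)
        also have "\<tau> x mod N + (j + N - \<tau> x mod N) = j + N"
          using mod_less_divisor[OF N, of "\<tau> x"] by simp
        also have "\<dots> mod N = j" using j by simp
        finally have mod: "(\<tau> x + i) mod N = j" .
        have "(T ^^ i) ((S ^^ i) x) = x" using x T_pow_S_pow[of x i i] by simp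
        then have "(S ^^ i) x \<in> space M - short_periodic L"
          using x short_periodic_pow_iff[of "(S ^^ i) x" i] by auto
        then have "\<kappa> ((S ^^ i) x) = j"
          using shift[OF x i past] mod N_le by (simp add: \<kappa>_def)
        with R i show False by blast
      qed
    qed
    then have "prob ?R \<le> prob ((\<Union>i<N. ?F i) \<union> (\<Union>i<N. ?B i))"
      by (intro finite_measure_mono) measurable
    also have "\<dots> \<le> prob (\<Union>i<N. ?F i) + prob (\<Union>i<N. ?B i)"
      by (intro measure_Un_le) measurable
    also have "prob (\<Union>i<N. ?F i) \<le> (\<Sum>i<N. prob (?F i))"
      by (intro finite_measure_subadditive_finite) auto
    also have "prob (\<Union>i<N. ?B i) \<le> (\<Sum>i<N. prob (?B i))"
      by (intro finite_measure_subadditive_finite) auto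
    finally have "prob ?R \<le> 2 * N * prob E"
      by (simp add: prob_vimage_pow prob_inverse_pow)
    then have "L * prob ?R \<le> L * (2 * N * prob E)"
      by (rule mult_left_mono) simp
    also have "\<dots> = 2 * N * (L * prob E)" by simp
    also have "\<dots> \<le> real (2 * N) * 1"
      using E_prob by (intro mult_left_mono) auto
    finally show ?thesis by simp
  qed
  show ?thesis
    by (rule that[OF simple le _ bound]) (simp add: \<kappa>_def)
qed

text \<open>The points that lie in no block of length \<open>N\<close> with first point in \<open>D\<close>. The points of short period are excluded, as
  they are labelled separately.\<close>

definition leftover :: "nat \<Rightarrow> nat \<Rightarrow> 'a set \<Rightarrow> 'a set" where
  "leftover N L D = {x\<in>space M - short_periodic L. \<forall>i<N. (S ^^ i) x \<notin> D}"

text \<open>The information needed to reconstruct a block code: the observable \<open>b\<close> (in the application, the atom of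
  \<open>\<beta>\<close>) at the first points of blocks, the default label at leftover points, and nothing inside blocks or at points of short period.\<close>

definition block_symbol :: "nat \<Rightarrow> nat \<Rightarrow> 'a set \<Rightarrow> ('a \<Rightarrow> 'b) \<Rightarrow> ('a \<Rightarrow> 'c) \<Rightarrow> 'a \<Rightarrow> ('b + 'c) option" where
  "block_symbol N L D b d x =
     (if x \<in> D then Some (Inl (b x)) else if x \<in> leftover N L D then Some (Inr (d x)) else None)"

lemma sets_leftover [measurable]: "D \<in> events \<Longrightarrow> leftover N L D \<in> events"
proof -
  assume [measurable]: "D \<in> events"
  have "leftover N L D = {x\<in>space M. x \<notin> short_periodic L \<and> (\<forall>i\<in>{..<N}. (S ^^ i) x \<notin> D)}"
    by (auto simp: leftover_def)
  also have "\<dots> \<in> events" by measurable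
  finally show ?thesis .
qed

lemma simple_function_block_symbol:
  assumes D: "D \<in> events" and b: "simple_function M b" and d: "simple_function M d"
  shows "simple_function M (block_symbol N L D b d)"
proof -
  have "simple_function M (\<lambda>x. if x \<in> D then Some (Inl (b x))
     else if x \<in> leftover N L D then Some (Inr (d x)) else None)"
    using D sets_leftover[OF D, of N L] 
      simple_function_compose1[OF b, of "\<lambda>v. Some (Inl v)"] simple_function_compose1[OF d, of "\<lambda>v. Some (Inr v)"]
    by (intro simple_function_If_set) auto
  then show ?thesis unfolding block_symbol_def .
qed

text \<open>The label \<open>g x\<close> of the block code is a function of the block symbols at \<open>x\<close> and at its previous \<open>N - 1\<close> points,
  together with the default label if \<open>x\<close> has short period. So the names of length \<open>n\<close> under \<open>g\<close> are determined by
  \<open>n + N\<close> consecutive block symbols and the names of the periodic part, which have bounded entropy. Dividing by \<open>n\<close>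
  leaves the entropy of a single block symbol.\<close>

lemma block_code:
  assumes U: "cover M \<U>" and N: "0 < N" and D: "D \<in> events" "D \<inter> short_periodic L = {}"
    and d: "simple_function M d" "\<And>x. x \<in> space M \<Longrightarrow> d x \<in> \<U> \<and> x \<in> d x"
    and b: "simple_function M b"
    and s: "\<And>x i. x \<in> space M \<Longrightarrow> i < N \<Longrightarrow> s i (b x) \<in> \<U> \<and> (T ^^ i) x \<in> s i (b x)"
  shows "h_plus M T \<U> \<le> sf_entropy M (block_symbol N L D b d)"
proof -
  define \<gamma> where "\<gamma> = block_symbol N L D b d"
  \<comment> \<open>The part of the label that comes from points of short period.\<close>
  define \<delta> where "\<delta> x = (if x \<in> short_periodic L then Some (d x) else None)" for x
  \<comment> \<open>The decoder: \<open>ys ! i\<close> is the block symbol \<open>i\<close> steps back, and the nearest block start determines the label.\<close>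
  define G where "G q ys = (case q of Some u \<Rightarrow> u | None \<Rightarrow>
      (case ys ! 0 of Some (Inr u) \<Rightarrow> u | _ \<Rightarrow>
        (let i = LEAST i. i < N \<and> (\<exists>v. ys ! i = Some (Inl v)) in s i (projl (the (ys ! i))))))"
    for q and ys :: "('b + 'a set) option list"
  define g where "g x = G (\<delta> x) (map (\<lambda>i. \<gamma> ((S ^^ i) x)) [0..<N])" for x
  have \<gamma>: "simple_function M \<gamma>"
    unfolding \<gamma>_def by (rule simple_function_block_symbol[OF D(1) b d(1)])
  have \<delta>: "simple_function M \<delta>"
    unfolding \<delta>_def[abs_def] using simple_function_compose1[OF d(1), of Some] sets_short_periodic[of L]
    by (intro simple_function_If_set) auto
  have "simple_function M (\<lambda>x. \<gamma> ((S ^^ i) x))" for i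
    using simple_function_comp[OF measurable_pow(2) \<gamma>] by (simp add: comp_def)
  then have g_simple: "simple_function M g"
    by (intro simple_function_factor[OF simple_function_Pair[OF \<delta> simple_function_map_upt],
          where f = "\<lambda>(q, ys). G q ys"]) (simp_all add: g_def)
  have g_sel: "g x \<in> \<U> \<and> x \<in> g x" if x: "x \<in> space M" for x
  proof -
    define ys where "ys = map (\<lambda>i. \<gamma> ((S ^^ i) x)) [0..<N]"
    have ys: "ys ! i = \<gamma> ((S ^^ i) x)" if "i < N" for i
      using that by (simp add: ys_def)
    have ys0: "ys ! 0 = \<gamma> x" using ys[OF N] by simp
    consider (P) "x \<in> short_periodic L" | (R) "x \<in> leftover N L D"
      | (B) "x \<notin> short_periodic L" "\<exists>i<N. (S ^^ i) x \<in> D"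
      using x by (auto simp: leftover_def)
    then show ?thesis
    proof cases
      case P
      then have "g x = d x" by (simp add: g_def \<delta>_def G_def)
      then show ?thesis using d(2)[OF x] by simp
    next
      case R
      then have "x \<notin> D" using N by (auto simp: leftover_def)
      with R have "ys ! 0 = Some (Inr (d x))" by (simp add: ys0 \<gamma>_def block_symbol_def)
      moreover have "\<delta> x = None" using R by (simp add: \<delta>_def leftover_def)
      ultimately have "g x = d x" by (simp add: g_def G_def flip: ys_def)
      then show ?thesis using d(2)[OF x] by simp
    next
      case B
      define i where "i = (LEAST i. i < N \<and> (\<exists>v. ys ! i = Some (Inl v)))"
      have "\<exists>i. i < N \<and> (\<exists>v. ys ! i = Some (Inl v))"
        using B(2) ys by (force simp: \<gamma>_def block_symbol_def)
      from LeastI_ex[OF this] obtain v where i: "i < N" and v: "ys ! i = Some (Inl v)"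
        unfolding i_def by blast
      have v_eq: "v = b ((S ^^ i) x)"
        using v ys[OF i] by (simp add: \<gamma>_def block_symbol_def split: if_splits)
      have "x \<notin> leftover N L D" using B by (auto simp: leftover_def)
      then have "ys ! 0 \<noteq> Some (Inr u)" for u
        by (simp add: ys0 \<gamma>_def block_symbol_def)
      then have "g x = s i v"
        using B(1) v unfolding g_def ys_def[symmetric] G_def \<delta>_def i_def[symmetric]
        by (auto split: option.split sum.split simp: Let_def)
      moreover have "(T ^^ i) ((S ^^ i) x) = x" using x T_pow_S_pow[of x i i] by simp
      ultimately show ?thesis
        using s[of "(S ^^ i) x" i] x i by (simp add: v_eq)
    qed
  qed
  define \<alpha> where "\<alpha> = (\<lambda>v. g -` {v} \<inter> space M) ` \<U>"
  note sel = selection_partition[OF U g_simple g_sel, folded \<alpha>_def]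
  define c where "c = sf_entropy M (name T \<delta> (fact L))"
  define h where "h = sf_entropy M \<gamma>"
  have \<delta>_name: "sf_entropy M (name T \<delta> n) \<le> c" for n
    unfolding c_def
  proof (rule sf_entropy_factor_le[OF simple_function_name[OF \<delta>],
        where f = "\<lambda>ys. map (\<lambda>k. ys ! (k mod fact L)) [0..<n]"])
    fix x assume x: "x \<in> space M"
    have "\<delta> ((T ^^ k) x) = \<delta> ((T ^^ (k mod fact L)) x)" for k
    proof (cases "x \<in> short_periodic L")
      case True
      then show ?thesis by (simp add: short_periodic_fact)
    next
      case False
      then show ?thesis using short_periodic_pow_iff[OF x] by (simp add: \<delta>_def)
    qed
    then show "name T \<delta> n x = map (\<lambda>k. name T \<delta> (fact L) x ! (k mod fact L)) [0..<n]"
      by (simp add: name_def)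
  qed
  have est: "partition_entropy M (iterated_join M T \<alpha> n) \<le> c + (n + N) * h" for n
  proof -
    have "partition_entropy M (iterated_join M T \<alpha> n) \<le> sf_entropy M (name T g n)"
      by (rule partition_entropy_iterated_join_le[OF sel(1) g_simple sel(3)])
    \<comment> \<open>Shifting by \<open>N\<close> turns the past symbols used by the decoder into symbols of the forward orbit of \<open>x\<close>.\<close>
    also have "\<dots> = sf_entropy M (\<lambda>x. name T g n ((T ^^ N) x))"
      by (rule sf_entropy_pow[OF simple_function_name[OF g_simple], symmetric])
    also have "\<dots> \<le> sf_entropy M (\<lambda>x. (name T \<delta> n ((T ^^ N) x), name T \<gamma> (n + N) x))"
    proof (rule sf_entropy_factor_le[OF simple_function_Pair[OF
            simple_function_pow[OF simple_function_name[OF \<delta>]] simple_function_name[OF \<gamma>]],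
          where f = "\<lambda>(qs, ys). map (\<lambda>k. G (qs ! k) (map (\<lambda>i. ys ! (k + N - i)) [0..<N])) [0..<n]"])
      fix x assume x: "x \<in> space M"
      have "g ((T ^^ k) ((T ^^ N) x)) =
          G (\<delta> ((T ^^ k) ((T ^^ N) x))) (map (\<lambda>i. name T \<gamma> (n + N) x ! (k + N - i)) [0..<N])"
        if "k < n" for k
        unfolding g_def using x that
        by (intro arg_cong2[of _ _ _ _ G] map_cong) (simp_all add: T_pow_add S_pow_T_pow)
      then show "name T g n ((T ^^ N) x) =
          (case (name T \<delta> n ((T ^^ N) x), name T \<gamma> (n + N) x) of (qs, ys) \<Rightarrow>
            map (\<lambda>k. G (qs ! k) (map (\<lambda>i. ys ! (k + N - i)) [0..<N])) [0..<n])"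
        by (intro nth_equalityI) simp_all
    qed
    also have "\<dots> \<le> sf_entropy M (name T \<delta> n) + sf_entropy M (name T \<gamma> (n + N))"
      using sf_entropy_Pair_le[OF simple_function_pow[OF simple_function_name[OF \<delta>]] simple_function_name[OF \<gamma>]]
      by (simp add: sf_entropy_pow[OF simple_function_name[OF \<delta>]])
    also have "\<dots> \<le> c + (n + N) * h"
      using \<delta>_name[of n] sf_entropy_name_le[OF \<gamma>, of "n + N"] by (simp add: h_def)
    finally show ?thesis .
  qed
  have "ks_entropy M T \<alpha> \<le> h"
  proof (rule LIMSEQ_le[OF ks_entropy_LIMSEQ[OF sel(1)]])
    have "(\<lambda>n. h + (c + N * h) / real n) \<longlonglongrightarrow> h + 0"
      by (intro tendsto_intros lim_const_over_n)
    then show "(\<lambda>n. h + (c + N * h) / real n) \<longlonglongrightarrow> h" by simp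
    have "partition_entropy M (iterated_join M T \<alpha> n) / n \<le> h + (c + N * h) / n" if "n \<ge> 1" for n
      using est[of n] that by (simp add: field_simps)
    then show "\<exists>k. \<forall>n\<ge>k. partition_entropy M (iterated_join M T \<alpha> n) / n \<le> h + (c + N * h) / n" by blast
  qed
  with h_plus_le[OF U sel(1,2)] show ?thesis by (simp add: h_def \<gamma>_def)
qed

text \<open>The entropy sum splits over the three kinds of symbols. The blank symbol, of probability \<open>p\<close>, contributes at
  most \<open>1 - p\<close>, which is the measure of block starts and leftover points; a leftover symbol has probability at most that of
  the leftover set, which is where \<open>\<epsilon>\<close> bounds \<open>eta\<close>.\<close>

lemma sf_entropy_block_symbol_le:
  fixes \<epsilon> :: real
  assumes D: "D \<in> events" and b: "simple_function M b"
    and d: "simple_function M d" "d ` space M \<subseteq> F" "finite F"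
    and \<epsilon>: "\<And>t. 0 \<le> t \<Longrightarrow> t \<le> prob (leftover N L D) \<Longrightarrow> eta t \<le> \<epsilon>"
  shows "sf_entropy M (block_symbol N L D b d) \<le>
    (\<Sum>v\<in>b ` space M. eta (prob (D \<inter> (b -` {v} \<inter> space M)))) + card F * \<epsilon> + prob D + prob (leftover N L D)"
proof -
  let ?\<gamma> = "block_symbol N L D b d" and ?R = "leftover N L D"
  let ?e = "\<lambda>v. eta (prob (?\<gamma> -` {v} \<inter> space M))"
  have R: "?R \<in> events" by (rule sets_leftover[OF D])
  have range: "?\<gamma> ` space M \<subseteq> insert None (Some ` (b ` space M <+> F))"
    using d(2) by (auto simp: block_symbol_def)
  have finb: "finite (b ` space M)" using simple_functionD(1)[OF b] .
  have "sf_entropy M ?\<gamma> = (\<Sum>v\<in>insert None (Some ` (b ` space M <+> F)). ?e v)"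
    by (rule sf_entropy_eq_sum[OF _ range]) (use finb d(3) in auto)
  also have "\<dots> = ?e None + (\<Sum>v\<in>b ` space M <+> F. ?e (Some v))"
    using finb d(3) by (subst sum.insert) (auto simp: sum.reindex)
  also have "(\<Sum>v\<in>b ` space M <+> F. ?e (Some v)) =
      (\<Sum>v\<in>b ` space M. ?e (Some (Inl v))) + (\<Sum>u\<in>F. ?e (Some (Inr u)))"
    using finb d(3) by (subst sum.Plus) simp_all
  also have "(\<Sum>v\<in>b ` space M. ?e (Some (Inl v))) =
      (\<Sum>v\<in>b ` space M. eta (prob (D \<inter> (b -` {v} \<inter> space M))))"
    by (intro sum.cong refl arg_cong[of _ _ eta] arg_cong[of _ _ prob])
      (auto simp: block_symbol_def split: if_splits)
  also have "(\<Sum>u\<in>F. ?e (Some (Inr u))) \<le> (\<Sum>u\<in>F. \<epsilon>)"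
  proof (intro sum_mono \<epsilon>)
    fix u show "prob (?\<gamma> -` {Some (Inr u)} \<inter> space M) \<le> prob ?R"
      by (rule finite_measure_mono[OF _ R]) (auto simp: block_symbol_def split: if_splits)
  qed simp
  also have "?e None \<le> prob D + prob ?R"
  proof -
    have None: "?\<gamma> -` {None} \<inter> space M = space M - (D \<union> ?R)"
      by (auto simp: block_symbol_def split: if_splits)
    have "?e None \<le> 1 - prob (?\<gamma> -` {None} \<inter> space M)" by (rule eta_le_one_minus) simp
    also have "\<dots> = prob (D \<union> ?R)"
      using prob_compl[of "D \<union> ?R"] D R by (simp add: None)
    also have "\<dots> \<le> prob D + prob ?R" by (rule measure_Un_le[OF D R])
    finally show ?thesis .
  qed
  finally show ?thesis by simp
qed

text \<open>The double sum is part of the entropy sum of the pair \<open>(\<kappa>, b)\<close>, the terms with \<open>\<kappa> = N\<close> being left out, and \<open>\<kappa>\<close> has at most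
  \<open>N + 1\<close> values.\<close>

lemma sum_eta_slices_le:
  fixes N :: nat
  assumes \<kappa>: "simple_function M \<kappa>" "\<And>x. \<kappa> x \<le> N" and b: "simple_function M b"
  shows "(\<Sum>j<N. \<Sum>v\<in>b ` space M. eta (prob ((\<kappa> -` {j} \<inter> space M) \<inter> (b -` {v} \<inter> space M))))
    \<le> ln (real N + 1) + sf_entropy M b"
proof -
  let ?X = "\<lambda>x. (\<kappa> x, b x)"
  let ?e = "\<lambda>w. eta (prob (?X -` {w} \<inter> space M))"
  have fin: "finite (b ` space M)" using simple_functionD(1)[OF b] .
  have "(\<Sum>j<N. \<Sum>v\<in>b ` space M. eta (prob ((\<kappa> -` {j} \<inter> space M) \<inter> (b -` {v} \<inter> space M))))
      = (\<Sum>j<N. \<Sum>v\<in>b ` space M. ?e (j, v))"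
    by (intro sum.cong refl arg_cong[of _ _ eta] arg_cong[of _ _ prob]) auto
  also have "\<dots> = (\<Sum>w\<in>{..<N} \<times> b ` space M. ?e w)"
    by (simp add: sum.cartesian_product)
  also have "\<dots> \<le> (\<Sum>w\<in>{..N} \<times> b ` space M. ?e w)"
    using fin by (intro sum_mono2) (auto intro!: eta_nonneg)
  also have "\<dots> = sf_entropy M ?X"
    using fin \<kappa>(2) by (intro sf_entropy_eq_sum[symmetric]) auto
  also have "\<dots> \<le> sf_entropy M \<kappa> + sf_entropy M b"
    by (rule sf_entropy_Pair_le[OF \<kappa>(1) b])
  also have "sf_entropy M \<kappa> \<le> ln (card {..N})"
    using \<kappa>(2) by (intro sf_entropy_le_card[OF \<kappa>(1)]) auto
  finally show ?thesis by (simp add: add.commute)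
qed

lemma eta_small:
  assumes "\<epsilon> > 0"
  obtains r where "r > 0" "\<And>t. 0 \<le> t \<Longrightarrow> t \<le> r \<Longrightarrow> eta t \<le> \<epsilon>"
proof -
  have "((\<lambda>t::real. - (t * ln t)) \<longlongrightarrow> 0) (at_right 0)" by real_asymp
  then have "\<forall>\<^sub>F t in at_right 0. eta t < \<epsilon>"
    using assms unfolding eta_def by (intro order_tendstoD(2)) 
  then obtain r where r: "r > 0" "\<And>t. 0 < t \<Longrightarrow> t < r \<Longrightarrow> eta t < \<epsilon>"
    unfolding eventually_at_right_field by auto
  show ?thesis
  proof (rule that[of "r / 2"])
    fix t :: real assume "0 \<le> t" "t \<le> r / 2"
    then show "eta t \<le> \<epsilon>" using r assms by (cases "t = 0") (auto intro!: less_imp_le)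
  qed (use r in simp)
qed

text \<open>Averaging the bound of \<open>block_code\<close> over all \<open>N\<close> residues. The constant \<open>2\<close> beside \<open>ln (N + 1)\<close> collects the slack
  in the choice of \<open>\<beta>\<close> and the total measure of the disjoint sets of block starts.\<close>

lemma h_plus_le_h_minus:
  assumes U: "cover M \<U>"
  shows "h_plus M T \<U> \<le> h_minus M T \<U>"
proof (rule field_le_epsilon)
  fix e :: real assume "e > 0"
  define \<epsilon> where "\<epsilon> = e / 4"
  have \<epsilon>: "\<epsilon> > 0" using \<open>e > 0\<close> by (simp add: \<epsilon>_def)
  let ?H = "\<lambda>n. cover_entropy M (iterated_join M T \<U> n)"
  have "\<forall>\<^sub>F n in sequentially. ?H n / n < h_minus M T \<U> + \<epsilon>"
    using \<epsilon> by (intro order_tendstoD(2)[OF h_minus_LIMSEQ[OF U]]) simp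
  moreover have "(\<lambda>n. (ln (real n + 1) + 2) / real n) \<longlonglongrightarrow> 0" by real_asymp
  then have "\<forall>\<^sub>F n in sequentially. (ln (real n + 1) + 2) / n < \<epsilon>"
    using \<epsilon> by (rule order_tendstoD(2))
  moreover have "\<forall>\<^sub>F n in sequentially. 0 < n" by (rule eventually_gt_at_top)
  ultimately have "\<forall>\<^sub>F n in sequentially. ?H n / n < h_minus M T \<U> + \<epsilon> \<and> (ln (real n + 1) + 2) / n < \<epsilon> \<and> 0 < n"
    by eventually_elim simp
  then obtain N where N: "?H N / N < h_minus M T \<U> + \<epsilon>" "(ln (real N + 1) + 2) / N < \<epsilon>" "0 < N"
    using eventually_happens by fastforce
  obtain \<beta> where \<beta>: "mpartition M \<beta>" "finer \<beta> (iterated_join M T \<U> N)" "partition_entropy M \<beta> < ?H N + 1"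
  proof -
    have "\<not> ?H N + 1 \<le> ?H N" by simp
    then show ?thesis
      using cover_entropy_greatest[OF cover_iterated_join[OF U, of N], of "?H N + 1"] that by (meson not_le)
  qed
  have "\<forall>B\<in>\<beta>. \<exists>s. \<forall>i<N. s i \<in> \<U> \<and> B \<subseteq> (T ^^ i) -` s i"
  proof
    fix B assume "B \<in> \<beta>"
    then obtain A where A: "A \<in> iterated_join M T \<U> N" "B \<subseteq> A" using \<beta>(2) unfolding finer_def by blast
    from iterated_join_itinerary[OF A(1)] obtain s where "\<forall>i<N. s i \<in> \<U> \<and> A \<subseteq> (T ^^ i) -` s i" ..
    with A(2) show "\<exists>s. \<forall>i<N. s i \<in> \<U> \<and> B \<subseteq> (T ^^ i) -` s i" by (intro exI[of _ s]) (auto dest: subsetD)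
  qed
  then obtain s where s: "\<forall>B\<in>\<beta>. \<forall>i<N. s B i \<in> \<U> \<and> B \<subseteq> (T ^^ i) -` s B i" by (rule bchoice[THEN exE])
  define b where "b = cell \<beta>"
  have b: "simple_function M b" unfolding b_def by (rule simple_function_cell[OF \<beta>(1)])
  have itin: "s (b x) i \<in> \<U> \<and> (T ^^ i) x \<in> s (b x) i" if "x \<in> space M" "i < N" for x i
    using s cell_in[OF \<beta>(1) that(1)] that(2) unfolding b_def by blast
  obtain d where d: "simple_function M d" "\<And>x. x \<in> space M \<Longrightarrow> d x \<in> \<U> \<and> x \<in> d x"
    using simple_selection[OF U] by blast
  have F: "finite \<U>" "d ` space M \<subseteq> \<U>" using U d(2) by (auto simp: cover_def)
  have "\<epsilon> / (card \<U> + 1) > 0" using \<epsilon> by simp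
  from eta_small[OF this] obtain r
    where r: "r > 0" "\<And>t. 0 \<le> t \<Longrightarrow> t \<le> r \<Longrightarrow> eta t \<le> \<epsilon> / (card \<U> + 1)" by metis
  obtain L :: nat where L: "2 * N / min r \<epsilon> < L" using reals_Archimedean2 by blast
  have m: "min r \<epsilon> > 0" using r \<epsilon> by simp
  have "0 \<le> 2 * N / min r \<epsilon>" using m by simp
  with L have "real L > 0" by linarith
  obtain \<kappa> :: "'a \<Rightarrow> nat" where \<kappa>: "simple_function M \<kappa>" "\<And>x. \<kappa> x \<le> N"
    "\<And>x. x \<in> short_periodic L \<Longrightarrow> \<kappa> x = N"
    "\<And>j. j < N \<Longrightarrow> L * prob {x\<in>space M - short_periodic L. \<forall>i<N. \<kappa> ((S ^^ i) x) \<noteq> j} \<le> 2 * N"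
    by (rule block_positions[OF N(3), of L], rule that)
  define D where "D j = \<kappa> -` {j} \<inter> space M" for j
  have D: "D j \<in> events" for j unfolding D_def by (rule simple_functionD(2)[OF \<kappa>(1)])
  have D_P: "D j \<inter> short_periodic L = {}" if "j < N" for j
    using that \<kappa>(3) by (auto simp: D_def)
  have R: "prob (leftover N L (D j)) \<le> min r \<epsilon>" if "j < N" for j
  proof -
    have "leftover N L (D j) = {x\<in>space M - short_periodic L. \<forall>i<N. \<kappa> ((S ^^ i) x) \<noteq> j}"
      by (auto simp: leftover_def D_def)
    with \<kappa>(4)[OF that] have "L * prob (leftover N L (D j)) \<le> 2 * N" by simp
    also have "\<dots> \<le> L * min r \<epsilon>" using L m by (simp add: pos_divide_less_eq)
    finally show ?thesis using \<open>real L > 0\<close> by simp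
  qed
  have "N * h_plus M T \<U> = (\<Sum>j<N. h_plus M T \<U>)" by simp
  also have "\<dots> \<le> (\<Sum>j<N. (\<Sum>v\<in>b ` space M. eta (prob (D j \<inter> (b -` {v} \<inter> space M)))) + prob (D j) + 2 * \<epsilon>)"
  proof (intro sum_mono)
    fix j assume "j \<in> {..<N}"
    then have j: "j < N" by simp
    have "h_plus M T \<U> \<le> sf_entropy M (block_symbol N L (D j) b d)"
      by (rule block_code[OF U N(3) D D_P[OF j] d b itin])
    also have "\<dots> \<le> (\<Sum>v\<in>b ` space M. eta (prob (D j \<inter> (b -` {v} \<inter> space M)))) + card \<U> * (\<epsilon> / (card \<U> + 1))
        + prob (D j) + prob (leftover N L (D j))"
    proof (rule sf_entropy_block_symbol_le[OF D b d(1) F(2,1)])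
      fix t :: real assume "0 \<le> t" "t \<le> prob (leftover N L (D j))"
      with R[OF j] show "eta t \<le> \<epsilon> / (card \<U> + 1)" by (intro r(2)) linarith+
    qed
    also have "card \<U> * (\<epsilon> / (card \<U> + 1)) \<le> \<epsilon>"
      using \<epsilon> by (simp add: field_simps)
    also have "prob (leftover N L (D j)) \<le> \<epsilon>" using R[OF j] by simp
    finally show "h_plus M T \<U> \<le> (\<Sum>v\<in>b ` space M. eta (prob (D j \<inter> (b -` {v} \<inter> space M)))) + prob (D j) + 2 * \<epsilon>"
      by simp
  qed
  also have "\<dots> = (\<Sum>j<N. \<Sum>v\<in>b ` space M. eta (prob (D j \<inter> (b -` {v} \<inter> space M)))) + (\<Sum>j<N. prob (D j)) + N * (2 * \<epsilon>)"
    by (simp add: sum.distrib)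
  also have "(\<Sum>j<N. \<Sum>v\<in>b ` space M. eta (prob (D j \<inter> (b -` {v} \<inter> space M)))) \<le> ln (real N + 1) + sf_entropy M b"
    using sum_eta_slices_le[OF \<kappa>(1,2) b] by (simp add: D_def)
  also have "(\<Sum>j<N. prob (D j)) = prob (\<Union>j<N. D j)"
  proof (rule finite_measure_finite_Union[symmetric])
    show "D ` {..<N} \<subseteq> events" using D by blast
    show "disjoint_family_on D {..<N}" unfolding disjoint_family_on_def D_def by blast
  qed simp
  also have "\<dots> \<le> 1" by simp
  also have "sf_entropy M b \<le> ?H N + 1"
    using \<beta>(3) partition_entropy_eq[OF \<beta>(1)] by (simp add: b_def)
  finally have "N * h_plus M T \<U> \<le> ?H N + (ln (real N + 1) + 2) + N * (2 * \<epsilon>)" by simp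
  also have "?H N \<le> N * (h_minus M T \<U> + \<epsilon>)" using N(1,3) by (simp add: pos_divide_less_eq mult.commute)
  also have "ln (real N + 1) + 2 \<le> N * \<epsilon>" using N(2,3) by (simp add: pos_divide_less_eq mult.commute)
  finally have "N * h_plus M T \<U> \<le> N * (h_minus M T \<U> + e)" by (simp add: \<epsilon>_def algebra_simps)
  then show "h_plus M T \<U> \<le> h_minus M T \<U> + e" using N(3) by simp
qed

end

theorem corollary5p2:
  fixes M :: "'a measure" and T :: "'a \<Rightarrow> 'a" and \<U> :: "'a set set"
  assumes "mt_dynamical_system M T"
    and "cover M \<U>"
  shows "h_plus M T \<U> = h_minus M T \<U>"
proof -
  interpret mt_dynamical_system M T by fact
  show ?thesis by (rule antisym[OF h_plus_le_h_minus[OF assms(2)] h_minus_le_h_plus[OF assms(2)]])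
qed

end
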